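(* Assume that $\operatorname{ran}L=\mathcal M$ and let $(\hat u,\hat q)$ be a primal-dual pair for the primal problem $\min_{u\in\mathcal B}f_b(Au)+\|Lu\|_{TV}$ and the dual problem $$\sup\left\{-f_b^*(q)\ :\ q\in\mathbb R^m,\ A^*q\in\operatorname{ran}L^*,\ \|(L^+)^*A^*q\|_\infty\le1\right\}.$$ Let $I(\hat q)=\{x\in\Omega:\ |((L^+)^*A^*\hat q)(x)|=1\}$. Then $$\operatorname{supp}(L\hat u)\subseteq I(\hat q).$$ In particular, if $I(\hat q)=\{x_1,\dots,x_p\}$, then $\hat u$ can be written as $$\hat u=u_K+\sum_{k=1}^p d_k\,L^+\delta_{x_k}$$ with $u_K\in\ker L$ and $(d_k)\in\mathbb R^p$. If the primal problem admits a unique solution, then $p\le\overline m:=m-\dim(A(\ker L))$, and $\hat u$ is the sparse solution of the primal problem that exists under the standing assumptions (i)-(iv), namely a solution of the form $v_K+\sum_{k=1}^{p'}c_k\,L^+\delta_{y_k}$ with $p'\le\overline m$, $v_K\in\ker L$, $(c_k)\in\mathbb R^{p'}$ and $(y_k)\in\Omega^{p'}$.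
   Context: Let $\Omega\subseteq\mathbb R^d$ be open, $\mathcal D'(\Omega)$ the space of distributions on $\Omega$, $C_0(\Omega)$ the space of continuous real functions on $\Omega$ vanishing at infinity (for every $\epsilon>0$ there is a compact $C\subset\Omega$ with $|f|<\epsilon$ off $C$), and $\mathcal M=\mathcal M(\Omega)=C_0(\Omega)^*$ the Banach space of Radon measures with the total variation norm $\|\cdot\|_{TV}$. For $x\in\Omega$, $\delta_x$ is the Dirac measure at $x$. Let $L:\mathcal D'(\Omega)\to\mathcal D'(\Omega)$ be a continuous linear operator and $\mathcal B^\circ=\{u\in\mathcal D'(\Omega): Lu\in\mathcal M(\Omega)\}$. Let $\|\cdot\|_K$ be a (possibly $+\infty$-valued) semi-norm on $\mathcal B^\circ$ whose restriction to $\ker L$ is a norm. Set $\mathcal B=\{u\in\mathcal D'(\Omega): Lu\in\mathcal M(\Omega),\ \|u\|_K<\infty\}$ with norm $\|u\|=\|Lu\|_{TV}+\|u\|_K$; from now on $L$ is regarded as an operator $\mathcal B\to\mathcal M$. Standing assumptions: (i) $\mathcal B$ is a Banach space. (ii) There is a closed subspace $V$ of $\mathcal B$ with $\ker L\oplus V=\mathcal B$; $\operatorname{ran}L$ is closed and has a complementary (closed) subspace $W$, $\operatorname{ran}L\oplus W=\mathcal M$. The pseudoinverse is $L^+=j_V(L|_V)^{-1}\Pi_{\operatorname{ran}L}:\mathcal M\to\mathcal B$, with $j_V:V\hookrightarrow\mathcal B$ the injection and $\Pi_{\operatorname{ran}L}$ the projection onto $\operatorname{ran}L$ along $W$. (iii)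 $a_1,\dots,a_m\in\mathcal B^*$ are such that $(L^+)^*a_i\in C_0(\Omega)$, i.e. there is $\rho_i\in C_0(\Omega)$ with $\langle(L^+)^*a_i,\mu\rangle=\int_\Omega\rho_i\,d\mu$ for all $\mu\in\mathcal M$. (iv) The primal problem has at least one solution. (v) $f_b:\mathbb R^m\to\mathbb R\cup\{+\infty\}$ is convex and lower semicontinuous. The measurement operator is $A:\mathcal B\to\mathbb R^m$, $(Au)_i=\langle a_i,u\rangle$; $A^*:\mathbb R^m\to\mathcal B^*$, $L^*:\mathcal M^*\to\mathcal B^*$, $(L^+)^*:\mathcal B^*\to\mathcal M^*$ are adjoints; $f_b^*$ is the Fenchel conjugate. One has $(L^+)^*A^*q=\sum_iq_i\rho_i\in C_0(\Omega)$. A primal-dual pair $(\hat u,\hat q)$ consists of a solution $\hat u$ of the primal problem and a solution $\hat q$ of the dual problem, the two optimal values being equal.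
   Formalization: The claim p ≤ m̄ with p = |I(q̂)| fails when some points of I(q̂) carry no mass of Lû; what is proved is that the number of nonzero coefficients d_k is at most m̄. Solutions of the primal problem are required to have finite objective value. *)

theory Defs
  imports "HOL-Analysis.Analysis" "HOL-Library.Function_Algebras"
begin

instantiation "fun" :: (type, real_vector) real_vector
begin

definition scaleR_fun :: "real \<Rightarrow> ('a \<Rightarrow> 'b) \<Rightarrow> 'a \<Rightarrow> 'b"
  where "scaleR_fun c f = (\<lambda>x. c *\<^sub>R f x)"

instance
  by standard (auto simp: scaleR_fun_def plus_fun_def fun_eq_iff scaleR_add_left scaleR_add_right)

end

section \<open>Normed spaces given by a carrier set and a norm function\<close>

definition linear_map_on ::
    "'v::real_vector set \<Rightarrow> ('v \<Rightarrow> 'w::real_vector) \<Rightarrow> bool" where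
  "linear_map_on S T \<longleftrightarrow>
     (\<forall>x\<in>S. \<forall>y\<in>S. T (x + y) = T x + T y) \<and> (\<forall>c. \<forall>x\<in>S. T (c *\<^sub>R x) = c *\<^sub>R T x)"

definition kernel_on ::
    "'v::real_vector set \<Rightarrow> ('v \<Rightarrow> 'w::real_vector) \<Rightarrow> 'v set" where
  "kernel_on S T = {x \<in> S. T x = 0}"

definition norm_on :: "'v::real_vector set \<Rightarrow> ('v \<Rightarrow> real) \<Rightarrow> bool" where
  "norm_on S n \<longleftrightarrow> subspace S \<and>
     (\<forall>x\<in>S. 0 \<le> n x \<and> (n x = 0 \<longleftrightarrow> x = 0)) \<and>
     (\<forall>c. \<forall>x\<in>S. n (c *\<^sub>R x) = \<bar>c\<bar> * n x) \<and>
     (\<forall>x\<in>S. \<forall>y\<in>S. n (x + y) \<le> n x + n y)"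

definition ext_seminorm_on :: "'v::real_vector set \<Rightarrow> ('v \<Rightarrow> ennreal) \<Rightarrow> bool" where
  "ext_seminorm_on S n \<longleftrightarrow>
     (\<forall>c. \<forall>x\<in>S. n (c *\<^sub>R x) = ennreal \<bar>c\<bar> * n x) \<and>
     (\<forall>x\<in>S. \<forall>y\<in>S. n (x + y) \<le> n x + n y)"

text \<open>The locale \<^locale>\<open>Metric_space\<close> requires symmetry and nonnegativity also outside the carrier.\<close>

definition norm_dist :: "'v::real_vector set \<Rightarrow> ('v \<Rightarrow> real) \<Rightarrow> 'v \<Rightarrow> 'v \<Rightarrow> real" where
  "norm_dist S n x y = (if x \<in> S \<and> y \<in> S then n (x - y) else 0)"

lemma Metric_space_norm_dist:
  assumes "norm_on S n"
  shows "Metric_space S (norm_dist S n)"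
proof
  have sub: "subspace S" and n0: "\<And>x. x \<in> S \<Longrightarrow> 0 \<le> n x \<and> (n x = 0 \<longleftrightarrow> x = 0)"
    and sc: "\<And>c x. x \<in> S \<Longrightarrow> n (c *\<^sub>R x) = \<bar>c\<bar> * n x"
    and tri: "\<And>x y. x \<in> S \<Longrightarrow> y \<in> S \<Longrightarrow> n (x + y) \<le> n x + n y"
    using assms by (auto simp: norm_on_def)
  note diff = subspace_diff[OF sub]
  show "0 \<le> norm_dist S n x y" for x y
    using n0[OF diff] by (auto simp: norm_dist_def)
  show "norm_dist S n x y = norm_dist S n y x" for x y
    using sc[OF diff, of x y "-1"] by (auto simp: norm_dist_def)
  show "norm_dist S n x y = 0 \<longleftrightarrow> x = y" if "x \<in> S" "y \<in> S" for x y
    using n0[OF diff] that by (auto simp: norm_dist_def)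
  show "norm_dist S n x z \<le> norm_dist S n x y + norm_dist S n y z"
    if "x \<in> S" "y \<in> S" "z \<in> S" for x y z
    using tri[OF diff diff, of x y y z] that by (simp add: norm_dist_def)
qed

definition banach_on :: "'v::real_vector set \<Rightarrow> ('v \<Rightarrow> real) \<Rightarrow> bool" where
  "banach_on S n \<longleftrightarrow> norm_on S n \<and> Metric_space.mcomplete S (norm_dist S n)"

definition norm_closed_on :: "'v::real_vector set \<Rightarrow> ('v \<Rightarrow> real) \<Rightarrow> 'v set \<Rightarrow> bool" where
  "norm_closed_on S n V \<longleftrightarrow> closedin (Metric_space.mtopology S (norm_dist S n)) V"

definition direct_sum :: "'v::real_vector set \<Rightarrow> 'v set \<Rightarrow> 'v set \<Rightarrow> bool" where
  "direct_sum U V S \<longleftrightarrow> subspace U \<and> subspace V \<and> U \<inter> V = {0} \<and> {u + v |u v. u \<in> U \<and> v \<in> V} = S"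

definition proj_along :: "'v::real_vector set \<Rightarrow> 'v set \<Rightarrow> 'v \<Rightarrow> 'v" where
  "proj_along R W y = (THE r. r \<in> R \<and> y - r \<in> W)"

definition pseudoinverse ::
    "'v::real_vector set \<Rightarrow> 'v set \<Rightarrow> 'w::real_vector set \<Rightarrow> ('v \<Rightarrow> 'w) \<Rightarrow> 'w \<Rightarrow> 'v" where
  "pseudoinverse S V W T y = the_inv_into V T (proj_along (T ` S) W y)"

text \<open>Functionals on a carrier \<open>S\<close> are extended by 0 outside \<open>S\<close>, so that equality of
  functions is equality of functionals on \<open>S\<close>.\<close>

definition dual_space :: "'v::real_vector set \<Rightarrow> ('v \<Rightarrow> real) \<Rightarrow> ('v \<Rightarrow> real) set" where
  "dual_space S n = {f. linear_map_on S f \<and> (\<exists>C. \<forall>x\<in>S. \<bar>f x\<bar> \<le> C * n x) \<and> (\<forall>x. x \<notin> S \<longrightarrow> f x = 0)}"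

definition dual_norm :: "'v::real_vector set \<Rightarrow> ('v \<Rightarrow> real) \<Rightarrow> ('v \<Rightarrow> real) \<Rightarrow> real" where
  "dual_norm S n f = (SUP x\<in>{x \<in> S. n x \<le> 1}. \<bar>f x\<bar>)"

definition adjoint_on :: "'v set \<Rightarrow> ('v \<Rightarrow> 'w) \<Rightarrow> ('w \<Rightarrow> real) \<Rightarrow> 'v \<Rightarrow> real" where
  "adjoint_on S T f = (\<lambda>x. if x \<in> S then f (T x) else 0)"


section \<open>Distributions\<close>

type_synonym 'a functional = "('a \<Rightarrow> real) \<Rightarrow> real"

primrec iter_deriv :: "'a::euclidean_space list \<Rightarrow> ('a \<Rightarrow> real) \<Rightarrow> 'a \<Rightarrow> real" where
  "iter_deriv [] f = f"
| "iter_deriv (v # vs) f = (\<lambda>x. frechet_derivative (iter_deriv vs f) (at x) v)"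

definition smooth :: "('a::euclidean_space \<Rightarrow> real) \<Rightarrow> bool" where
  "smooth f \<longleftrightarrow> (\<forall>vs. set vs \<subseteq> Basis \<longrightarrow> (\<forall>x. iter_deriv vs f differentiable (at x)))"

definition test_functions :: "'a::euclidean_space set \<Rightarrow> ('a \<Rightarrow> real) set" where
  "test_functions \<Omega> =
     {\<phi>. smooth \<phi> \<and> compact (closure {x. \<phi> x \<noteq> 0}) \<and> closure {x. \<phi> x \<noteq> 0} \<subseteq> \<Omega>}"

definition test_norm :: "nat \<Rightarrow> ('a::euclidean_space \<Rightarrow> real) \<Rightarrow> real" where
  "test_norm N \<phi> = (\<Sum>vs | set vs \<subseteq> Basis \<and> length vs \<le> N. SUP x. \<bar>iter_deriv vs \<phi> x\<bar>)"

text \<open>Continuity of a linear functional on the test functions is expressed by the usual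
  seminorm estimates on each compact set.\<close>

definition distributions :: "'a::euclidean_space set \<Rightarrow> 'a functional set" where
  "distributions \<Omega> =
     {u. linear_map_on (test_functions \<Omega>) u \<and>
         (\<forall>K. compact K \<and> K \<subseteq> \<Omega> \<longrightarrow>
            (\<exists>C N. \<forall>\<phi>\<in>test_functions \<Omega>. closure {x. \<phi> x \<noteq> 0} \<subseteq> K \<longrightarrow> \<bar>u \<phi>\<bar> \<le> C * test_norm N \<phi>)) \<and>
         (\<forall>\<phi>. \<phi> \<notin> test_functions \<Omega> \<longrightarrow> u \<phi> = 0)}"

text \<open>The topology on \<^const>\<open>distributions\<close> is the weak-* one: as distributions vanish off the
  test functions, it is the trace of the product topology of the function type. (For linear
  operators, weak-* continuity and continuity for the strong dual topology coincide.)\<close>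

definition continuous_linear_operator ::
    "'a::euclidean_space set \<Rightarrow> ('a functional \<Rightarrow> 'a functional) \<Rightarrow> bool" where
  "continuous_linear_operator \<Omega> L \<longleftrightarrow>
     L \<in> distributions \<Omega> \<rightarrow> distributions \<Omega> \<and>
     linear_map_on (distributions \<Omega>) L \<and> continuous_on (distributions \<Omega>) L"


section \<open>Radon measures\<close>

text \<open>Elements of \<open>C0 \<Omega>\<close> are extended by 0 to the whole space, so their supremum norm may be
  taken over the whole type.\<close>

definition C0 :: "'a::euclidean_space set \<Rightarrow> ('a \<Rightarrow> real) set" where
  "C0 \<Omega> = {f. continuous_on \<Omega> f \<and>
     (\<forall>\<epsilon>>0. \<exists>C. compact C \<and> C \<subseteq> \<Omega> \<and> (\<forall>x\<in>\<Omega> - C. \<bar>f x\<bar> < \<epsilon>)) \<and> (\<forall>x. x \<notin> \<Omega> \<longrightarrow> f x = 0)}"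

definition sup_norm :: "('a \<Rightarrow> real) \<Rightarrow> real" where
  "sup_norm f = (SUP x. \<bar>f x\<bar>)"

text \<open>A Radon measure \<open>\<mu>\<close> is a bounded functional on \<open>C0 \<Omega>\<close>; thus \<open>\<mu> f\<close> is the integral of \<open>f\<close>
  with respect to \<open>\<mu>\<close>.\<close>

definition radon :: "'a::euclidean_space set \<Rightarrow> 'a functional set" where
  "radon \<Omega> = dual_space (C0 \<Omega>) sup_norm"

definition tv_norm :: "'a::euclidean_space set \<Rightarrow> 'a functional \<Rightarrow> real" where
  "tv_norm \<Omega> = dual_norm (C0 \<Omega>) sup_norm"

definition dirac :: "'a::euclidean_space set \<Rightarrow> 'a \<Rightarrow> 'a functional" where
  "dirac \<Omega> x = (\<lambda>f. if f \<in> C0 \<Omega> then f x else 0)"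

definition supp_measure :: "'a::euclidean_space set \<Rightarrow> 'a functional \<Rightarrow> 'a set" where
  "supp_measure \<Omega> \<mu> = \<Omega> - \<Union>{U. open U \<and> U \<subseteq> \<Omega> \<and>
     (\<forall>f\<in>C0 \<Omega>. compact (closure {x. f x \<noteq> 0}) \<and> closure {x. f x \<noteq> 0} \<subseteq> U \<longrightarrow> \<mu> f = 0)}"

definition measure_to_distribution ::
    "'a::euclidean_space set \<Rightarrow> 'a functional \<Rightarrow> 'a functional" where
  "measure_to_distribution \<Omega> \<mu> = (\<lambda>\<phi>. if \<phi> \<in> test_functions \<Omega> then \<mu> \<phi> else 0)"

text \<open>For \<open>F\<close> in the dual of \<open>radon \<Omega>\<close>, the condition that \<open>F\<close> belongs to \<open>C0 \<Omega>\<close> refers to the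
  canonical embedding of \<open>C0 \<Omega>\<close> into its bidual; \<open>C0_repr\<close> is the function that represents \<open>F\<close>.\<close>

definition represents :: "'a::euclidean_space set \<Rightarrow> ('a \<Rightarrow> real) \<Rightarrow> ('a functional \<Rightarrow> real) \<Rightarrow> bool" where
  "represents \<Omega> \<rho> F \<longleftrightarrow> \<rho> \<in> C0 \<Omega> \<and> (\<forall>\<mu>\<in>radon \<Omega>. F \<mu> = \<mu> \<rho>)"

lemma C0_vanishes:
  assumes "f \<in> C0 \<Omega>" "e > 0"
  obtains C where "compact C" "C \<subseteq> \<Omega>" "\<forall>x\<in>\<Omega> - C. \<bar>f x\<bar> < e"
  using assms unfolding C0_def by blast

lemma C0_le_sup_norm:
  assumes "f \<in> C0 \<Omega>"
  shows "\<bar>f x\<bar> \<le> sup_norm f"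
proof -
  obtain C where C: "compact C" "C \<subseteq> \<Omega>" "\<forall>x\<in>\<Omega> - C. \<bar>f x\<bar> < 1"
    using C0_vanishes[OF assms zero_less_one] .
  have "continuous_on C f"
    using assms C(2) continuous_on_subset unfolding C0_def by blast
  then have "bounded (f ` C)"
    using C(1) compact_continuous_image compact_imp_bounded by blast
  then obtain b where b: "\<forall>x\<in>C. \<bar>f x\<bar> \<le> b"
    by (auto simp: bounded_iff)
  have "\<bar>f x\<bar> \<le> max b 1" for x
  proof (cases "x \<in> \<Omega>")
    case True
    then show ?thesis using b C(3) by (cases "x \<in> C") (force simp: le_max_iff_disj)+
  next
    case False
    then show ?thesis using assms by (auto simp: C0_def)
  qed
  then have "bdd_above (range (\<lambda>x. \<bar>f x\<bar>))"
    by (auto simp: bdd_above_def)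
  then show ?thesis
    unfolding sup_norm_def by (rule cSUP_upper[OF UNIV_I])
qed

lemma subspace_C0: "subspace (C0 \<Omega>)"
proof (rule subspaceI)
  show "0 \<in> C0 \<Omega>"
    unfolding C0_def zero_fun_def by (auto intro!: exI[where x="{}"])
next
  fix f g assume f: "f \<in> C0 \<Omega>" and g: "g \<in> C0 \<Omega>"
  have "\<exists>C. compact C \<and> C \<subseteq> \<Omega> \<and> (\<forall>x\<in>\<Omega> - C. \<bar>f x + g x\<bar> < e)" if e: "e > 0" for e
  proof -
    obtain C where C: "compact C" "C \<subseteq> \<Omega>" "\<forall>x\<in>\<Omega> - C. \<bar>f x\<bar> < e/2"
      using C0_vanishes[OF f half_gt_zero[OF e]] .
    obtain D where D: "compact D" "D \<subseteq> \<Omega>" "\<forall>x\<in>\<Omega> - D. \<bar>g x\<bar> < e/2"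
      using C0_vanishes[OF g half_gt_zero[OF e]] .
    have "\<bar>f x + g x\<bar> < e" if "x \<in> \<Omega> - (C \<union> D)" for x
    proof -
      have "\<bar>f x\<bar> < e/2" "\<bar>g x\<bar> < e/2" using C(3) D(3) that by auto
      then show ?thesis by linarith
    qed
    then show ?thesis using C D by (intro exI[of _ "C \<union> D"]) auto
  qed
  then show "f + g \<in> C0 \<Omega>"
    using f g by (auto simp: C0_def plus_fun_def intro: continuous_on_add)
next
  fix c f assume f: "f \<in> C0 \<Omega>"
  have "\<exists>C. compact C \<and> C \<subseteq> \<Omega> \<and> (\<forall>x\<in>\<Omega> - C. \<bar>c * f x\<bar> < e)" if "e > 0" for e
  proof (cases "c = 0")
    case True
    then show ?thesis using that by (intro exI[of _ "{}"]) auto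
  next
    case False
    then have pos: "e / \<bar>c\<bar> > 0" using that by simp
    obtain C where C: "compact C" "C \<subseteq> \<Omega>" "\<forall>x\<in>\<Omega> - C. \<bar>f x\<bar> < e / \<bar>c\<bar>"
      using C0_vanishes[OF f pos] .
    have "\<bar>c * f x\<bar> < e" if "x \<in> \<Omega> - C" for x
      using C(3) that False by (auto simp: abs_mult pos_less_divide_eq mult.commute)
    then show ?thesis using C by blast
  qed
  then show "c *\<^sub>R f \<in> C0 \<Omega>"
    using f by (auto simp: C0_def scaleR_fun_def intro: continuous_on_mult_left)
qed

lemma dirac_radon: "dirac \<Omega> x \<in> radon \<Omega>"
proof -
  have "(f + g) x = f x + g x" "(c *\<^sub>R f) x = c * f x" for f g :: "'a \<Rightarrow> real" and c
    by (simp_all add: scaleR_fun_def)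
  then have "linear_map_on (C0 \<Omega>) (dirac \<Omega> x)"
    using subspace_add[OF subspace_C0, of _ \<Omega>] subspace_scale[OF subspace_C0, of _ \<Omega>]
    by (simp add: linear_map_on_def dirac_def del: plus_fun_apply)
  then show ?thesis
    using C0_le_sup_norm[of _ \<Omega> x]
    by (auto simp: radon_def dual_space_def dirac_def intro!: exI[of _ 1])
qed

lemma represents_unique:
  assumes "represents \<Omega> \<rho> F" "represents \<Omega> \<rho>' F"
  shows "\<rho> = \<rho>'"
proof
  fix x
  show "\<rho> x = \<rho>' x"
    using assms dirac_radon[of \<Omega> x] by (auto simp: represents_def dirac_def split: if_splits)
qed

definition C0_repr :: "'a::euclidean_space set \<Rightarrow> ('a functional \<Rightarrow> real) \<Rightarrow> 'a \<Rightarrow> real" where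
  "C0_repr \<Omega> F = (THE \<rho>. represents \<Omega> \<rho> F)"


section \<open>The Banach space associated with the operator\<close>

definition B_circ ::
    "'a::euclidean_space set \<Rightarrow> ('a functional \<Rightarrow> 'a functional) \<Rightarrow> 'a functional set" where
  "B_circ \<Omega> L = {u \<in> distributions \<Omega>. L u \<in> measure_to_distribution \<Omega> ` radon \<Omega>}"

definition B_space ::
    "'a::euclidean_space set \<Rightarrow> ('a functional \<Rightarrow> 'a functional) \<Rightarrow> ('a functional \<Rightarrow> ennreal)
     \<Rightarrow> 'a functional set" where
  "B_space \<Omega> L nK = {u \<in> B_circ \<Omega> L. nK u < \<infinity>}"

text \<open>\<open>L\<close> as a measure-valued operator: a measure is determined by its values on test functions,
  as these are dense in \<open>C0 \<Omega>\<close>.\<close>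

definition L_meas ::
    "'a::euclidean_space set \<Rightarrow> ('a functional \<Rightarrow> 'a functional) \<Rightarrow> 'a functional \<Rightarrow> 'a functional" where
  "L_meas \<Omega> L u = the_inv_into (radon \<Omega>) (measure_to_distribution \<Omega>) (L u)"

definition B_norm ::
    "'a::euclidean_space set \<Rightarrow> ('a functional \<Rightarrow> 'a functional) \<Rightarrow> ('a functional \<Rightarrow> ennreal)
     \<Rightarrow> 'a functional \<Rightarrow> real" where
  "B_norm \<Omega> L nK u = tv_norm \<Omega> (L_meas \<Omega> L u) + enn2real (nK u)"

definition L_kernel ::
    "'a::euclidean_space set \<Rightarrow> ('a functional \<Rightarrow> 'a functional) \<Rightarrow> ('a functional \<Rightarrow> ennreal)
     \<Rightarrow> 'a functional set" where
  "L_kernel \<Omega> L nK = kernel_on (B_space \<Omega> L nK) (L_meas \<Omega> L)"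

definition L_range ::
    "'a::euclidean_space set \<Rightarrow> ('a functional \<Rightarrow> 'a functional) \<Rightarrow> ('a functional \<Rightarrow> ennreal)
     \<Rightarrow> 'a functional set" where
  "L_range \<Omega> L nK = L_meas \<Omega> L ` B_space \<Omega> L nK"

definition L_pinv ::
    "'a::euclidean_space set \<Rightarrow> ('a functional \<Rightarrow> 'a functional) \<Rightarrow> ('a functional \<Rightarrow> ennreal)
     \<Rightarrow> 'a functional set \<Rightarrow> 'a functional set \<Rightarrow> 'a functional \<Rightarrow> 'a functional" where
  "L_pinv \<Omega> L nK V W = pseudoinverse (B_space \<Omega> L nK) V W (L_meas \<Omega> L)"


section \<open>The primal and the dual problem\<close>

definition convex_ereal :: "('v::real_vector \<Rightarrow> ereal) \<Rightarrow> bool" where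
  "convex_ereal f \<longleftrightarrow> (\<forall>x y t. 0 \<le> t \<and> t \<le> 1 \<longrightarrow>
     f ((1 - t) *\<^sub>R x + t *\<^sub>R y) \<le> ereal (1 - t) * f x + ereal t * f y)"

definition lower_semicontinuous :: "('v::topological_space \<Rightarrow> ereal) \<Rightarrow> bool" where
  "lower_semicontinuous f \<longleftrightarrow> (\<forall>x. f x \<le> Liminf (at x) f)"

definition fenchel_conjugate :: "('v::real_inner \<Rightarrow> ereal) \<Rightarrow> 'v \<Rightarrow> ereal" where
  "fenchel_conjugate f q = (SUP y. ereal (q \<bullet> y) - f y)"

definition measurement :: "('m::finite \<Rightarrow> 'v \<Rightarrow> real) \<Rightarrow> 'v \<Rightarrow> real ^ 'm" where
  "measurement a u = (\<chi> i. a i u)"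

definition measurement_adjoint ::
    "'v set \<Rightarrow> ('m::finite \<Rightarrow> 'v \<Rightarrow> real) \<Rightarrow> real ^ 'm \<Rightarrow> 'v \<Rightarrow> real" where
  "measurement_adjoint S a q = adjoint_on S (measurement a) (\<lambda>y. q \<bullet> y)"

definition primal_objective ::
    "'a::euclidean_space set \<Rightarrow> ('a functional \<Rightarrow> 'a functional) \<Rightarrow> ('m::finite \<Rightarrow> 'a functional \<Rightarrow> real)
     \<Rightarrow> (real ^ 'm \<Rightarrow> ereal) \<Rightarrow> 'a functional \<Rightarrow> ereal" where
  "primal_objective \<Omega> L a fb u = fb (measurement a u) + ereal (tv_norm \<Omega> (L_meas \<Omega> L u))"

text \<open>A solution of the primal problem is required to be feasible, i.e. to have a finite objective.\<close>

definition primal_solution ::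
    "'a::euclidean_space set \<Rightarrow> ('a functional \<Rightarrow> 'a functional) \<Rightarrow> ('a functional \<Rightarrow> ennreal)
     \<Rightarrow> ('m::finite \<Rightarrow> 'a functional \<Rightarrow> real) \<Rightarrow> (real ^ 'm \<Rightarrow> ereal) \<Rightarrow> 'a functional \<Rightarrow> bool" where
  "primal_solution \<Omega> L nK a fb u \<longleftrightarrow>
     u \<in> B_space \<Omega> L nK \<and> primal_objective \<Omega> L a fb u < \<infinity> \<and>
     (\<forall>v\<in>B_space \<Omega> L nK. primal_objective \<Omega> L a fb u \<le> primal_objective \<Omega> L a fb v)"

text \<open>\<open>certificate \<dots> q\<close> is \<open>(L\<^sup>+)\<^sup>* A\<^sup>* q\<close> as a function on \<open>\<Omega>\<close>.\<close>

definition certificate ::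
    "'a::euclidean_space set \<Rightarrow> ('a functional \<Rightarrow> 'a functional) \<Rightarrow> ('a functional \<Rightarrow> ennreal)
     \<Rightarrow> 'a functional set \<Rightarrow> 'a functional set \<Rightarrow> ('m::finite \<Rightarrow> 'a functional \<Rightarrow> real)
     \<Rightarrow> real ^ 'm \<Rightarrow> 'a \<Rightarrow> real" where
  "certificate \<Omega> L nK V W a q =
     C0_repr \<Omega> (adjoint_on (radon \<Omega>) (L_pinv \<Omega> L nK V W)
       (measurement_adjoint (B_space \<Omega> L nK) a q))"

definition dual_feasible ::
    "'a::euclidean_space set \<Rightarrow> ('a functional \<Rightarrow> 'a functional) \<Rightarrow> ('a functional \<Rightarrow> ennreal)
     \<Rightarrow> 'a functional set \<Rightarrow> 'a functional set \<Rightarrow> ('m::finite \<Rightarrow> 'a functional \<Rightarrow> real)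
     \<Rightarrow> (real ^ 'm) set" where
  "dual_feasible \<Omega> L nK V W a =
     {q. measurement_adjoint (B_space \<Omega> L nK) a q
           \<in> adjoint_on (B_space \<Omega> L nK) (L_meas \<Omega> L) ` dual_space (radon \<Omega>) (tv_norm \<Omega>) \<and>
         sup_norm (certificate \<Omega> L nK V W a q) \<le> 1}"

definition dual_solution ::
    "'a::euclidean_space set \<Rightarrow> ('a functional \<Rightarrow> 'a functional) \<Rightarrow> ('a functional \<Rightarrow> ennreal)
     \<Rightarrow> 'a functional set \<Rightarrow> 'a functional set \<Rightarrow> ('m::finite \<Rightarrow> 'a functional \<Rightarrow> real)
     \<Rightarrow> (real ^ 'm \<Rightarrow> ereal) \<Rightarrow> real ^ 'm \<Rightarrow> bool" where
  "dual_solution \<Omega> L nK V W a fb q \<longleftrightarrow>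
     q \<in> dual_feasible \<Omega> L nK V W a \<and>
     (\<forall>r\<in>dual_feasible \<Omega> L nK V W a. - fenchel_conjugate fb r \<le> - fenchel_conjugate fb q)"

definition primal_dual_pair ::
    "'a::euclidean_space set \<Rightarrow> ('a functional \<Rightarrow> 'a functional) \<Rightarrow> ('a functional \<Rightarrow> ennreal)
     \<Rightarrow> 'a functional set \<Rightarrow> 'a functional set \<Rightarrow> ('m::finite \<Rightarrow> 'a functional \<Rightarrow> real)
     \<Rightarrow> (real ^ 'm \<Rightarrow> ereal) \<Rightarrow> 'a functional \<Rightarrow> real ^ 'm \<Rightarrow> bool" where
  "primal_dual_pair \<Omega> L nK V W a fb u q \<longleftrightarrow>
     primal_solution \<Omega> L nK a fb u \<and> dual_solution \<Omega> L nK V W a fb q \<and>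
     (INF v\<in>B_space \<Omega> L nK. primal_objective \<Omega> L a fb v) =
       (SUP r\<in>dual_feasible \<Omega> L nK V W a. - fenchel_conjugate fb r)"

definition extremal_set ::
    "'a::euclidean_space set \<Rightarrow> ('a functional \<Rightarrow> 'a functional) \<Rightarrow> ('a functional \<Rightarrow> ennreal)
     \<Rightarrow> 'a functional set \<Rightarrow> 'a functional set \<Rightarrow> ('m::finite \<Rightarrow> 'a functional \<Rightarrow> real)
     \<Rightarrow> real ^ 'm \<Rightarrow> 'a set" where
  "extremal_set \<Omega> L nK V W a q = {x \<in> \<Omega>. \<bar>certificate \<Omega> L nK V W a q x\<bar> = 1}"

definition sparsity_bound ::
    "'a::euclidean_space set \<Rightarrow> ('a functional \<Rightarrow> 'a functional) \<Rightarrow> ('a functional \<Rightarrow> ennreal)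
     \<Rightarrow> ('m::finite \<Rightarrow> 'a functional \<Rightarrow> real) \<Rightarrow> nat" where
  "sparsity_bound \<Omega> L nK a = CARD('m) - dim (measurement a ` L_kernel \<Omega> L nK)"

end

theory Submission
  imports Defs
begin

text \<open>
  Write \<open>\<mu> = L u\<^sub>0\<close> and let \<open>\<eta>\<close> be the certificate of \<open>q\<^sub>0\<close>, so \<open>\<bar>\<eta>\<bar> \<le> 1\<close>. The Fenchel inequality and the
  absence of a duality gap give \<open>\<parallel>\<mu>\<parallel> \<le> - \<langle>q\<^sub>0, A u\<^sub>0\<rangle>\<close> for the total variation norm
  (\<open>primal_dual_pair_tv_norm_le\<close>). As \<open>A\<^sup>* q\<^sub>0\<close> is in the range of \<open>L\<^sup>*\<close>, it vanishes on the kernel of \<open>L\<close>, and the right-hand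
  side equals the integral of \<open>\<zeta> = - \<eta>\<close> with respect to \<open>\<mu>\<close>. Hence \<open>\<mu>\<close>, as a functional on the unit
  ball of \<open>C0\<close>, attains its norm at \<open>\<zeta>\<close>. The theorem follows from this maximality by two perturbation
  arguments within the Banach algebra \<open>C0\<close>; measures remain functionals throughout.

  \<^item> Where \<open>\<bar>\<zeta>\<bar> < 1\<close>, small multiples of functions with small support can be added to \<open>\<zeta>\<close> without
    leaving the unit ball, so \<open>\<mu>\<close> vanishes there (\<open>supp_subset_norming_set\<close>). This is the inclusion of
    the support in the extremal set.

  \<^item> For a function \<open>g\<close> with \<open>\<bar>g\<bar> \<le> 1\<close>, the measure \<open>(1 + g) \<mu>\<close> has norm at most the integral of
    \<open>(1 + g) \<zeta>\<close> with respect to \<open>\<mu>\<close>, which is affine in \<open>g\<close> (\<open>tv_norm_reweight_le\<close>). If the support had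
    more points than \<open>\<real>\<^sup>m / A (ker L)\<close> has dimensions, then some \<open>g \<mu> \<noteq> 0\<close>, with \<open>g\<close> a combination of
    bumps at these points, could be lifted to a direction on which \<open>A\<close> vanishes. Moving \<open>u\<^sub>0\<close> along it
    with the right sign would give a second solution (\<open>card_supp_le_if_unique\<close>). So for a
    unique solution the support is finite, whether or not the extremal set is.

  A measure with finite support is a combination of Dirac measures (\<open>finite_supp_sum_dirac\<close>), because it
  annihilates every function in \<open>C0\<close> that vanishes on its support (\<open>radon_eq_0_if_vanishes_on_supp\<close>);
  applying \<open>L\<^sup>+\<close>, which is a linear right inverse of \<open>L\<close>, yields the representations of \<open>u\<^sub>0\<close>.

  That \<open>L\<close> is well defined and linear as an operator into the measures relies on the density of the test
  functions in \<open>C0\<close> (\<open>test_functions_dense\<close>), which is derived from the Weierstrass theorem and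
  smooth bumps built from \<open>exp (- (1 / t))\<close>.
\<close>

section \<open>Functions vanishing at infinity\<close>

lemma sum_fun_apply: "(\<Sum>i\<in>I. f i) x = (\<Sum>i\<in>I. f i x)"
  by (induction I rule: infinite_finite_induct) simp_all

lemma C0_compact_supportI:
  assumes "continuous_on \<Omega> f" "compact C" "C \<subseteq> \<Omega>" "\<And>x. x \<notin> C \<Longrightarrow> f x = 0"
  shows "f \<in> C0 \<Omega>"
proof -
  have "\<exists>C. compact C \<and> C \<subseteq> \<Omega> \<and> (\<forall>x\<in>\<Omega> - C. \<bar>f x\<bar> < e)" if "e > 0" for e
    using assms(2-4) that by (intro exI[of _ C]) simp
  then show ?thesis
    using assms(1,3,4) unfolding C0_def by blast
qed

lemma C0_compact_closureI:
  assumes "continuous_on \<Omega> f" "compact (closure {x. f x \<noteq> 0})" "closure {x. f x \<noteq> 0} \<subseteq> \<Omega>"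
  shows "f \<in> C0 \<Omega>"
proof (rule C0_compact_supportI[OF assms])
  show "f x = 0" if "x \<notin> closure {x. f x \<noteq> 0}" for x
    using that closure_subset[of "{x. f x \<noteq> 0}"] by blast
qed

lemma sup_norm_le: "(\<And>x. \<bar>f x\<bar> \<le> c) \<Longrightarrow> sup_norm f \<le> c"
  unfolding sup_norm_def by (rule cSUP_least) auto

lemma C0_sup_norm_nonneg: "f \<in> C0 \<Omega> \<Longrightarrow> 0 \<le> sup_norm f"
  by (rule order_trans[OF abs_ge_zero C0_le_sup_norm])

lemma C0_mult:
  assumes f: "f \<in> C0 \<Omega>" and g: "g \<in> C0 \<Omega>"
  shows "(\<lambda>x. f x * g x) \<in> C0 \<Omega>"
proof -
  have "\<exists>C. compact C \<and> C \<subseteq> \<Omega> \<and> (\<forall>x\<in>\<Omega> - C. \<bar>f x * g x\<bar> < e)" if e: "e > 0" for e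
  proof -
    have pos: "e / (sup_norm g + 1) > 0"
      using e C0_sup_norm_nonneg[OF g] by simp
    obtain C where C: "compact C" "C \<subseteq> \<Omega>" "\<forall>x\<in>\<Omega> - C. \<bar>f x\<bar> < e / (sup_norm g + 1)"
      using C0_vanishes[OF f pos] .
    have "\<bar>f x * g x\<bar> < e" if "x \<in> \<Omega> - C" for x
    proof -
      have "\<bar>f x * g x\<bar> \<le> \<bar>f x\<bar> * (sup_norm g + 1)"
        unfolding abs_mult using C0_le_sup_norm[OF g, of x] by (intro mult_left_mono) auto
      also have "\<dots> < e"
        using C(3) that C0_sup_norm_nonneg[OF g] by (simp add: pos_less_divide_eq)
      finally show ?thesis .
    qed
    then show ?thesis using C by blast
  qed
  then show ?thesis
    using f g unfolding C0_def by (auto intro: continuous_on_mult)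
qed

text \<open>Soft thresholding: moving all values by \<open>e\<close> towards \<open>0\<close> leaves something nonzero only where
  \<open>\<bar>f\<bar> > e\<close>, that is, inside a compact set that avoids the zeros of \<open>f\<close>. This reduces statements
  about functions vanishing on a set to functions with compact support away from that set.\<close>

lemma C0_truncate:
  assumes f: "f \<in> C0 \<Omega>" and e: "e > 0"
  obtains g C where "g \<in> C0 \<Omega>" "compact C" "C \<subseteq> \<Omega>" "\<And>x. x \<notin> C \<Longrightarrow> g x = 0"
    "\<And>x. x \<in> C \<Longrightarrow> f x \<noteq> 0" "\<And>x. \<bar>f x - g x\<bar> \<le> e"
proof -
  define g where "g x = f x - max (- e) (min e (f x))" for x
  define C where "C = {x \<in> \<Omega>. e \<le> \<bar>f x\<bar>}"
  obtain D where D: "compact D" "D \<subseteq> \<Omega>" "\<forall>x\<in>\<Omega> - D. \<bar>f x\<bar> < e"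
    using C0_vanishes[OF f e] .
  have cf: "continuous_on \<Omega> f" and f0: "\<And>x. x \<notin> \<Omega> \<Longrightarrow> f x = 0"
    using f by (auto simp: C0_def)
  have CD: "C = D \<inter> (\<lambda>x. \<bar>f x\<bar>) -` {e..}"
    using D by (force simp: C_def)
  have "continuous_on D (\<lambda>x. \<bar>f x\<bar>)"
    by (intro continuous_intros continuous_on_subset[OF cf D(2)])
  then have "closed C"
    unfolding CD using D(1) by (intro continuous_closed_preimage) (auto simp: compact_imp_closed)
  then have C: "compact C"
    using compact_Int_closed[OF D(1), of C] by (simp add: CD Int_absorb1)
  have gC: "g x = 0" if "x \<notin> C" for x
    using that f0[of x] e by (cases "x \<in> \<Omega>") (auto simp: C_def g_def)
  have "continuous_on \<Omega> g"
    unfolding g_def by (intro continuous_intros cf)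
  then have g: "g \<in> C0 \<Omega>"
    using C gC by (intro C0_compact_supportI[of _ _ C]) (auto simp: C_def)
  have fg: "\<bar>f x - g x\<bar> \<le> e" for x
    using e by (auto simp: g_def)
  have "C \<subseteq> \<Omega>" "\<And>x. x \<in> C \<Longrightarrow> f x \<noteq> 0"
    using e by (auto simp: C_def)
  from that[OF g C this(1) gC this(2) fg] show thesis .
qed

text \<open>The quotient is continuous because \<open>\<Omega>\<close> is covered by two open sets: the complement of \<open>C\<close>, where
  the quotient is \<open>0\<close>, and the set of points where \<open>g\<close> does not vanish.\<close>

lemma C0_divide:
  assumes \<Omega>: "open \<Omega>" and g: "continuous_on \<Omega> g" and f: "f \<in> C0 \<Omega>"
    and C: "compact C" "C \<subseteq> \<Omega>" "\<And>x. x \<notin> C \<Longrightarrow> f x = 0" "\<And>x. x \<in> C \<Longrightarrow> g x \<noteq> 0"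
  shows "(\<lambda>x. f x / g x) \<in> C0 \<Omega>"
proof (rule C0_compact_supportI[of _ _ C])
  have op: "open (\<Omega> - C)" "open (\<Omega> \<inter> g -` (- {0}))"
    using open_Diff[OF \<Omega> compact_imp_closed[OF C(1)]]
      continuous_open_preimage[OF g \<Omega>, of "- {0}"] by (simp_all add: open_Compl)
  have "continuous_on (\<Omega> - C) (\<lambda>x. f x / g x)"
    using continuous_on_const[of "\<Omega> - C" "0::real"]
    by (rule continuous_on_cong[OF refl, THEN iffD1, rotated]) (simp add: C(3))
  moreover have "continuous_on (\<Omega> \<inter> g -` (- {0})) (\<lambda>x. f x / g x)"
  proof (rule continuous_on_divide)
    show "continuous_on (\<Omega> \<inter> g -` (- {0})) f"
      by (rule continuous_on_subset[OF _ Int_lower1]) (use f in \<open>simp add: C0_def\<close>)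
    show "continuous_on (\<Omega> \<inter> g -` (- {0})) g"
      by (rule continuous_on_subset[OF g Int_lower1])
  qed simp
  ultimately have "continuous_on ((\<Omega> - C) \<union> (\<Omega> \<inter> g -` (- {0}))) (\<lambda>x. f x / g x)"
    using op by (intro continuous_on_open_Un)
  then show "continuous_on \<Omega> (\<lambda>x. f x / g x)"
    by (rule continuous_on_subset) (use C(2,4) in blast)
qed (simp_all add: C)

lemma C0_bump:
  assumes U: "open U" "U \<subseteq> \<Omega>" "x \<in> U"
  obtains e where "e \<in> C0 \<Omega>" "e x = 1"
    "compact (closure {y. e y \<noteq> 0})" "closure {y. e y \<noteq> 0} \<subseteq> U"
proof -
  obtain r where r: "r > 0" "cball x r \<subseteq> U"
    using U open_contains_cball by blast
  define e where "e y = max 0 (1 - dist x y / r)" for y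
  have "{y. e y \<noteq> 0} \<subseteq> cball x r"
  proof
    fix y assume "y \<in> {y. e y \<noteq> 0}"
    then have "dist x y / r \<le> 1"
      unfolding e_def by (simp add: max_def split: if_splits)
    then show "y \<in> cball x r"
      using r(1) by simp
  qed
  then have ne: "closure {y. e y \<noteq> 0} \<subseteq> cball x r"
    by (rule closure_minimal[OF _ closed_cball])
  have comp: "compact (closure {y. e y \<noteq> 0})"
    using bounded_subset[OF bounded_cball ne] by (simp add: compact_eq_bounded_closed)
  have "continuous_on \<Omega> e"
    unfolding e_def using r(1) by (intro continuous_intros) simp
  then have "e \<in> C0 \<Omega>"
    using ne r(2) U(2) by (intro C0_compact_closureI comp) blast+
  moreover have "e x = 1"
    by (simp add: e_def)
  moreover have "closure {y. e y \<noteq> 0} \<subseteq> U"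
    using ne r(2) by blast
  ultimately show thesis
    using comp by (intro that)
qed

lemma C0_separating_bumps:
  assumes \<Omega>: "open \<Omega>" and F: "finite F" "F \<subseteq> \<Omega>"
  obtains e where "\<And>y. y \<in> F \<Longrightarrow> e y \<in> C0 \<Omega>"
    "\<And>y z. y \<in> F \<Longrightarrow> z \<in> F \<Longrightarrow> e y z = (if y = z then 1 else (0::real))"
proof -
  have "\<exists>e. e \<in> C0 \<Omega> \<and> (\<forall>z\<in>F. e z = (if y = z then 1 else (0::real)))" if "y \<in> F" for y
  proof -
    have "open (\<Omega> - (F - {y}))"
      using \<Omega> F(1) by (intro open_Diff finite_imp_closed finite_Diff)
    moreover have "y \<in> \<Omega> - (F - {y})"
      using F(2) that by blast
    ultimately obtain e where e: "e \<in> C0 \<Omega>" "e y = 1" "closure {z. e z \<noteq> 0} \<subseteq> \<Omega> - (F - {y})"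
      by (rule C0_bump[OF _ Diff_subset])
    have "e z = 0" if "z \<in> F" "z \<noteq> y" for z
      using e(3) closure_subset[of "{z. e z \<noteq> 0}"] that by blast
    then show ?thesis
      using e(1,2) by (intro exI[of _ e]) simp
  qed
  then have "\<forall>y\<in>F. \<exists>e. e \<in> C0 \<Omega> \<and> (\<forall>z\<in>F. e z = (if y = z then 1 else (0::real)))"
    by blast
  from bchoice[OF this] obtain e
    where "\<forall>y\<in>F. e y \<in> C0 \<Omega> \<and> (\<forall>z\<in>F. e y z = (if y = z then 1 else (0::real)))" ..
  then show thesis
    by (intro that[of e]) simp_all
qed

section \<open>Test functions are dense\<close>

text \<open>Smoothness of a function follows from membership in a family of differentiable functions that is
  closed under partial derivatives.\<close>

lemma smooth_coinduct:
  assumes "f \<in> F"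
    and diff: "\<And>g x. g \<in> F \<Longrightarrow> g differentiable (at x)"
    and step: "\<And>g v. g \<in> F \<Longrightarrow> v \<in> Basis \<Longrightarrow> (\<lambda>x. frechet_derivative g (at x) v) \<in> F"
  shows "smooth f"
proof -
  have "iter_deriv vs f \<in> F" if "set vs \<subseteq> Basis" for vs
    using that by (induction vs) (auto intro: assms(1) step)
  then show ?thesis
    using diff by (auto simp: smooth_def)
qed

text \<open>\<open>flat 0\<close> is the standard smooth function that is flat at \<open>0\<close>; the powers of \<open>t\<close> in the
  denominator make the linear span of the \<open>flat k\<close> closed under differentiation.\<close>

definition flat :: "nat \<Rightarrow> real \<Rightarrow> real" where
  "flat k t = (if t > 0 then exp (- (1 / t)) / t ^ k else 0)"

lemma mult_flat_Suc: "t * flat (Suc k) t = flat k t"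
  by (simp add: flat_def)

text \<open>The exponential series dominates each of its terms, so \<open>exp (1 / t)\<close> absorbs any power of \<open>1 / t\<close>;
  the quadratic bound gives differentiability at \<open>0\<close>.\<close>

lemma flat_bound: "\<bar>flat k t\<bar> \<le> fact (k + 2) * t\<^sup>2"
proof (cases "t > 0")
  case True
  have "(\<Sum>n\<in>{k + 2}. (1 / t) ^ n /\<^sub>R fact n) \<le> (\<Sum>n. (1 / t) ^ n /\<^sub>R fact n)"
    using True by (intro sum_le_suminf summable_exp_generic) auto
  then have "1 / (fact (k + 2) * t ^ (k + 2)) \<le> exp (1 / t)"
    by (simp add: exp_def power_one_over inverse_eq_divide mult.commute del: fact_Suc add_2_eq_Suc')
  then have "inverse (exp (1 / t)) \<le> inverse (1 / (fact (k + 2) * t ^ (k + 2)))"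
    using True by (intro le_imp_inverse_le) simp_all
  then have "exp (- (1 / t)) \<le> fact (k + 2) * t ^ (k + 2)"
    by (simp add: exp_minus del: fact_Suc add_2_eq_Suc')
  then have "exp (- (1 / t)) / t ^ k \<le> fact (k + 2) * t ^ (k + 2) / t ^ k"
    using True by (intro divide_right_mono) auto
  also have "\<dots> = fact (k + 2) * t\<^sup>2"
    using True by (simp add: power_add power2_eq_square)
  finally show ?thesis using True by (simp add: flat_def)
qed (simp add: flat_def)

lemma flat_has_derivative:
  "(flat k has_real_derivative flat (k + 2) t - k * flat (k + 1) t) (at t)"
proof (cases t "0::real" rule: linorder_cases)
  case less
  have "(flat k has_real_derivative 0) (at t)"
    by (rule has_field_derivative_transform_within_open[where f = "\<lambda>_. 0" and S = "{..<0}"])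
       (use less in \<open>simp_all add: flat_def\<close>)
  then show ?thesis using less by (simp add: flat_def)
next
  case equal
  have "((\<lambda>h. flat k h / h) \<longlongrightarrow> 0) (at 0)"
  proof (rule Lim_null_comparison)
    have "norm (flat k h / h) \<le> fact (k + 2) * \<bar>h\<bar>" if "h \<noteq> 0" for h
    proof -
      have "\<bar>flat k h\<bar> / \<bar>h\<bar> \<le> fact (k + 2) * h\<^sup>2 / \<bar>h\<bar>"
        by (intro divide_right_mono flat_bound) auto
      also have "\<dots> = fact (k + 2) * (\<bar>h\<bar>\<^sup>2 / \<bar>h\<bar>)"
        by simp
      also have "\<bar>h\<bar>\<^sup>2 / \<bar>h\<bar> = \<bar>h\<bar>"
        unfolding power2_eq_square by (rule nonzero_mult_div_cancel_left) (use that in simp)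
      finally show ?thesis
        by (simp add: abs_divide)
    qed
    then show "\<forall>\<^sub>F h in at 0. norm (flat k h / h) \<le> fact (k + 2) * \<bar>h\<bar>"
      by (simp add: eventually_at_filter)
    show "((\<lambda>h. fact (k + 2) * \<bar>h\<bar>) \<longlongrightarrow> 0) (at (0::real))"
      by (auto intro!: tendsto_eq_intros)
  qed
  then have "(flat k has_real_derivative 0) (at 0)"
    by (simp add: has_field_derivative_iff flat_def[of k 0])
  then show ?thesis using equal by (simp add: flat_def)
next
  case greater
  have "((\<lambda>t. exp (- (1 / t)) / t ^ k) has_real_derivative
      (exp (- (1 / t)) * (1 / (t * t)) * t ^ k - exp (- (1 / t)) * (k * t ^ (k - 1))) / (t ^ k * t ^ k)) (at t)"
    using greater by (auto intro!: derivative_eq_intros)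
  moreover have "(exp (- (1 / t)) * (1 / (t * t)) * t ^ k - exp (- (1 / t)) * (k * t ^ (k - 1))) / (t ^ k * t ^ k)
      = flat (k + 2) t - k * flat (k + 1) t"
    using greater by (cases k) (simp_all add: flat_def field_simps)
  ultimately have "((\<lambda>t. exp (- (1 / t)) / t ^ k) has_real_derivative flat (k + 2) t - k * flat (k + 1) t) (at t)"
    by simp
  then show ?thesis
    by (rule has_field_derivative_transform_within_open[where S = "{0<..}"])
       (use greater in \<open>simp_all add: flat_def\<close>)
qed

lemma real_polynomial_function_frechet_derivative:
  fixes p :: "'a::euclidean_space \<Rightarrow> real"
  assumes "real_polynomial_function p"
  shows "real_polynomial_function (\<lambda>x. frechet_derivative p (at x) v)"
  using assms
proof (induction rule: real_polynomial_function.induct)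
  case (linear f)
  have "frechet_derivative f (at x) = f" for x
    using linear by (intro frechet_derivative_at[symmetric] bounded_linear_imp_has_derivative)
  then show ?case by (simp add: real_polynomial_function.intros)
next
  case (const c)
  then show ?case by (simp add: real_polynomial_function.intros)
next
  case (add f g)
  have "frechet_derivative (\<lambda>x. f x + g x) (at x)
      = (\<lambda>h. frechet_derivative f (at x) h + frechet_derivative g (at x) h)" for x
    using add.hyps
    by (intro frechet_derivative_at[symmetric] has_derivative_add
        frechet_derivative_works[THEN iffD1] differentiable_at_real_polynomial_function)
  then show ?case using add.IH by (simp add: real_polynomial_function.intros)
next
  case (mult f g)
  have "frechet_derivative (\<lambda>x. f x * g x) (at x)
      = (\<lambda>h. f x * frechet_derivative g (at x) h + frechet_derivative f (at x) h * g x)" for x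
    using mult.hyps
    by (intro frechet_derivative_at[symmetric] has_derivative_mult
        frechet_derivative_works[THEN iffD1] differentiable_at_real_polynomial_function)
  then show ?case
    using mult by (simp add: real_polynomial_function.intros)
qed

text \<open>By the relation between the \<open>flat k\<close>, a partial derivative of \<open>p * flat k (s)\<close> can be put over
  the common factor \<open>flat (k + 2) (s)\<close>, so products of this form are closed under partial derivatives.\<close>

lemma smooth_polynomial_times_flat:
  fixes p s :: "'a::euclidean_space \<Rightarrow> real"
  assumes p: "real_polynomial_function p" and s: "real_polynomial_function s"
  shows "smooth (\<lambda>x. p x * flat k (s x))"
proof (rule smooth_coinduct)
  let ?F = "{\<lambda>x. p x * flat k (s x) | p k. real_polynomial_function p}"
  show "(\<lambda>x. p x * flat k (s x)) \<in> ?F" using p by blast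
  have deriv: "((\<lambda>x. p x * flat k (s x)) has_derivative
      (\<lambda>h. p x * ((flat (k + 2) (s x) - k * flat (k + 1) (s x)) * frechet_derivative s (at x) h)
         + frechet_derivative p (at x) h * flat k (s x))) (at x)"
    if "real_polynomial_function p" for p :: "'a \<Rightarrow> real" and k x
  proof (rule has_derivative_mult)
    show "(p has_derivative frechet_derivative p (at x)) (at x)"
      by (rule frechet_derivative_works[THEN iffD1, OF differentiable_at_real_polynomial_function[OF that]])
    have "(s has_derivative frechet_derivative s (at x)) (at x)"
      by (rule frechet_derivative_works[THEN iffD1, OF differentiable_at_real_polynomial_function[OF s]])
    then show "((\<lambda>x. flat k (s x)) has_derivative
        (\<lambda>h. (flat (k + 2) (s x) - k * flat (k + 1) (s x)) * frechet_derivative s (at x) h)) (at x)"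
      using flat_has_derivative[of k "s x"] unfolding has_field_derivative_def
      by (rule has_derivative_compose)
  qed
  show "g differentiable (at x)" if "g \<in> ?F" for g x
    using that deriv unfolding differentiable_def by blast
  show "(\<lambda>x. frechet_derivative g (at x) v) \<in> ?F" if gF: "g \<in> ?F" for g v
  proof -
    obtain p k where g: "g = (\<lambda>x. p x * flat k (s x))" and p: "real_polynomial_function p"
      using gF by blast
    define p' where "p' = (\<lambda>x. frechet_derivative p (at x) v)"
    define s' where "s' = (\<lambda>x. frechet_derivative s (at x) v)"
    have "frechet_derivative g (at x) v
        = (p x * s' x - k * (p x * s' x * s x) + p' x * (s x)\<^sup>2) * flat (k + 2) (s x)" for x
    proof -
      have f: "flat k (s x) = (s x)\<^sup>2 * flat (k + 2) (s x)" "flat (k + 1) (s x) = s x * flat (k + 2) (s x)"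
        by (simp_all add: power2_eq_square mult.assoc mult_flat_Suc)
      show ?thesis
        unfolding g frechet_derivative_at[OF deriv[OF p], symmetric] f p'_def[symmetric] s'_def[symmetric]
        by (simp add: algebra_simps p'_def s'_def)
    qed
    moreover have "real_polynomial_function
        (\<lambda>x. p x * s' x - k * (p x * s' x * s x) + p' x * (s x)\<^sup>2)"
      unfolding p'_def s'_def
      by (intro real_polynomial_function.intros real_polynomial_function_diff
          real_polynomial_function_power real_polynomial_function_frechet_derivative p s)
    ultimately show ?thesis
      by (intro CollectI exI[of _ "\<lambda>x. p x * s' x - k * (p x * s' x * s x) + p' x * (s x)\<^sup>2"]
          exI[of _ "k + 2"]) simp
  qed
qed

lemma test_functions_subset_C0: "test_functions \<Omega> \<subseteq> C0 \<Omega>"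
proof
  fix \<phi> assume \<phi>: "\<phi> \<in> test_functions \<Omega>"
  have "\<phi> differentiable (at x)" for x
    using \<phi> by (auto simp: test_functions_def smooth_def dest: spec[of _ "[]"])
  then have "continuous_on \<Omega> \<phi>"
    by (meson continuous_at_imp_continuous_on differentiable_imp_continuous_within)
  then show "\<phi> \<in> C0 \<Omega>"
    using \<phi> by (intro C0_compact_closureI) (simp_all add: test_functions_def)
qed

text \<open>Around each point there is a smooth bump function, positive exactly on a small ball; its products with
  polynomials are test functions again.\<close>

lemma polynomial_bump:
  assumes "cball c r \<subseteq> \<Omega>" "r > 0" "real_polynomial_function p"
  shows "(\<lambda>x. p x * flat 0 (r\<^sup>2 - (x - c) \<bullet> (x - c))) \<in> test_functions \<Omega>"
proof -
  define s where "s x = r\<^sup>2 - (x - c) \<bullet> (x - c)" for x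
  have s: "real_polynomial_function s"
  proof -
    note poly = real_polynomial_function.intros
    have "real_polynomial_function (\<lambda>x::'a. \<Sum>b\<in>Basis. (x \<bullet> b)\<^sup>2)"
      by (intro real_polynomial_function_sum real_polynomial_function_power
          poly(1) bounded_linear_inner_left) simp
    moreover have "(\<lambda>x. x \<bullet> x) = (\<lambda>x::'a. \<Sum>b\<in>Basis. (x \<bullet> b)\<^sup>2)"
      by (simp add: fun_eq_iff euclidean_inner[of x x for x] power2_eq_square)
    ultimately have "real_polynomial_function (\<lambda>x::'a. x \<bullet> x)"
      by simp
    moreover have "real_polynomial_function ((\<bullet>) c)"
      by (rule poly(1)[OF bounded_linear_inner_right])
    ultimately have "real_polynomial_function (\<lambda>x. r\<^sup>2 - (x \<bullet> x - 2 * (c \<bullet> x) + c \<bullet> c))"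
      by (intro real_polynomial_function_diff[OF poly(2)] poly(3)[OF _ poly(2)]
          real_polynomial_function_diff[OF _ poly(4)[OF poly(2)]])
    moreover have "s = (\<lambda>x. r\<^sup>2 - (x \<bullet> x - 2 * (c \<bullet> x) + c \<bullet> c))"
      by (simp add: s_def fun_eq_iff inner_diff inner_commute)
    ultimately show ?thesis by simp
  qed
  have supp: "closure {x. p x * flat 0 (s x) \<noteq> 0} \<subseteq> cball c r"
  proof (rule closure_minimal[OF _ closed_cball], rule subsetI)
    fix x assume "x \<in> {x. p x * flat 0 (s x) \<noteq> 0}"
    then have "(norm (x - c))\<^sup>2 \<le> r\<^sup>2"
      by (auto simp: flat_def s_def dot_square_norm split: if_splits)
    then show "x \<in> cball c r"
      using assms(2) by (simp add: dist_norm norm_minus_commute power2_le_iff_abs_le)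
  qed
  moreover have "compact (closure {x. p x * flat 0 (s x) \<noteq> 0})"
    using bounded_subset[OF bounded_cball supp] by (simp add: compact_eq_bounded_closed)
  ultimately have "(\<lambda>x. p x * flat 0 (s x)) \<in> test_functions \<Omega>"
    using assms(1) smooth_polynomial_times_flat[OF assms(3) s] unfolding test_functions_def by blast
  then show ?thesis by (simp add: s_def)
qed

text \<open>After truncation \<open>f\<close> has compact support. Dividing by a sum \<open>s\<close> of smooth bumps that is positive on
  this support leaves a continuous function on the compact set \<open>K\<close> that carries the bumps, where the
  Weierstrass theorem yields a polynomial \<open>p\<close>. Multiplying by \<open>s\<close> again turns \<open>p\<close> into a sum of test
  functions, and the error outside \<open>K\<close> is \<open>0\<close>.\<close>

lemma test_functions_dense:
  assumes \<Omega>: "open \<Omega>" and f: "f \<in> C0 \<Omega>" and e: "e > 0"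
  obtains \<phi> where "\<phi> \<in> span (test_functions \<Omega>)" "\<And>x. \<bar>f x - \<phi> x\<bar> \<le> e"
proof -
  obtain g C where g: "g \<in> C0 \<Omega>" and C: "compact C" "C \<subseteq> \<Omega>" "\<And>x. x \<notin> C \<Longrightarrow> g x = 0"
    and fg: "\<And>x. \<bar>f x - g x\<bar> \<le> e / 2"
    using C0_truncate[OF f half_gt_zero[OF e]] by metis
  obtain r where r: "\<And>c. c \<in> C \<Longrightarrow> r c > 0 \<and> cball c (r c) \<subseteq> \<Omega>"
  proof -
    have "\<forall>c\<in>C. \<exists>r>0. cball c r \<subseteq> \<Omega>"
      using \<Omega> C(2) open_contains_cball by blast
    then show thesis using that by metis
  qed
  obtain I where I: "I \<subseteq> C" "finite I" "C \<subseteq> (\<Union>c\<in>I. ball c (r c))"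
    by (rule compactE_image[OF C(1), of C "\<lambda>c. ball c (r c)"]) (use r in \<open>auto intro: that\<close>)
  define b where "b c x = flat 0 ((r c)\<^sup>2 - (x - c) \<bullet> (x - c))" for c x
  define s where "s x = (\<Sum>c\<in>I. b c x)" for x
  define K where "K = (\<Union>c\<in>I. cball c (r c))"
  have b0: "0 \<le> b c x" for c x
    by (simp add: b_def flat_def)
  have b_pos: "0 < b c x \<longleftrightarrow> x \<in> ball c (r c)" if "c \<in> I" for c x
  proof -
    have "(x - c) \<bullet> (x - c) < (r c)\<^sup>2 \<longleftrightarrow> norm (x - c) < r c"
      using r[of c] I(1) that by (auto simp: dot_square_norm not_le[symmetric] power_mono_iff less_imp_le)
    then show ?thesis
      by (simp add: b_def flat_def dist_norm norm_minus_commute)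
  qed
  have test: "(\<lambda>x. p x * b c x) \<in> test_functions \<Omega>" if "c \<in> I" "real_polynomial_function p" for c p
    unfolding b_def using polynomial_bump[of c "r c" \<Omega> p] r I(1) that by blast
  have "(\<lambda>x. 1 * b c x) \<in> test_functions \<Omega>" if "c \<in> I" for c
    by (rule test[OF that real_polynomial_function.intros(2)])
  then have b_C0: "b c \<in> C0 \<Omega>" if "c \<in> I" for c
    using test_functions_subset_C0 that by auto
  have "s = (\<Sum>c\<in>I. b c)"
    by (simp add: fun_eq_iff s_def sum_fun_apply)
  then have s: "s \<in> C0 \<Omega>"
    using b_C0 by (simp add: subspace_sum[OF subspace_C0])
  have s0: "0 \<le> s x" for x
    unfolding s_def by (intro sum_nonneg b0)
  have s_pos: "s x \<noteq> 0" if "x \<in> C" for x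
  proof -
    obtain c where "c \<in> I" "x \<in> ball c (r c)"
      using I(3) \<open>x \<in> C\<close> by blast
    then have "0 < s x"
      unfolding s_def using b_pos b0 I(2) by (intro sum_pos2[of _ c]) blast+
    then show ?thesis by simp
  qed
  have sK: "s x = 0" if "x \<notin> K" for x
    unfolding s_def
  proof (rule sum.neutral, rule ballI)
    fix c assume c: "c \<in> I"
    then have "x \<notin> ball c (r c)"
      using that ball_subset_cball[of c "r c"] unfolding K_def by blast
    then show "b c x = 0"
      using b_pos[OF c, of x] b0[of c x] by linarith
  qed
  have K: "compact K" "K \<subseteq> \<Omega>"
    unfolding K_def using I(1,2) r by (blast intro: compact_UN compact_cball)+
  have "(\<lambda>x. g x / s x) \<in> C0 \<Omega>"
    using s C s_pos by (intro C0_divide[OF \<Omega> _ g C]) (auto simp: C0_def)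
  then have "continuous_on K (\<lambda>x. g x / s x)"
    using K(2) by (auto simp: C0_def intro: continuous_on_subset)
  moreover define S where "S = sup_norm s + 1"
  have S: "0 < S"
    unfolding S_def using C0_sup_norm_nonneg[OF s] by simp
  then have "0 < e / 2 / S"
    using e by simp
  ultimately obtain p where p: "real_polynomial_function p"
    "\<And>x. x \<in> K \<Longrightarrow> \<bar>g x / s x - p x\<bar> < e / 2 / S"
    using Stone_Weierstrass_real_polynomial_function[OF K(1)] by blast
  have gp: "\<bar>g x - p x * s x\<bar> \<le> e / 2" for x
  proof (cases "x \<in> K")
    case True
    have "g x = (g x / s x) * s x"
      using C(3) s_pos by (cases "x \<in> C") simp_all
    then have "\<bar>g x - p x * s x\<bar> = \<bar>g x / s x - p x\<bar> * s x"
      by (metis abs_mult abs_of_nonneg left_diff_distrib s0)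
    also have "\<dots> \<le> e / 2 / S * S"
      using p(2)[OF True] C0_le_sup_norm[OF s, of x] s0[of x] S by (intro mult_mono) (simp_all add: S_def)
    finally show ?thesis using S by simp
  next
    case False
    then have "x \<notin> C"
      using I(3) unfolding K_def by force
    then show ?thesis using C(3) sK[OF False] e by simp
  qed
  have fp: "\<bar>f x - p x * s x\<bar> \<le> e" for x
    using fg[of x] gp[of x] by linarith
  have "(\<lambda>x. p x * s x) = (\<Sum>c\<in>I. (\<lambda>x. p x * b c x))"
    by (simp add: fun_eq_iff s_def sum_fun_apply sum_distrib_left)
  then have "(\<lambda>x. p x * s x) \<in> span (test_functions \<Omega>)"
    using test[OF _ p(1)] by (simp add: span_sum span_base)
  then show thesis using fp by (rule that)
qed

section \<open>Radon measures\<close>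

lemma C0_lincomb:
  assumes "f \<in> C0 \<Omega>" "g \<in> C0 \<Omega>"
  shows "(\<lambda>x. a * f x + b * g x) \<in> C0 \<Omega>"
proof -
  have "a *\<^sub>R f + b *\<^sub>R g \<in> C0 \<Omega>"
    using assms by (intro subspace_add[OF subspace_C0] subspace_scale[OF subspace_C0])
  then show ?thesis by (simp add: plus_fun_def scaleR_fun_def)
qed

lemma radon_lincomb:
  assumes \<mu>: "\<mu> \<in> radon \<Omega>" and f: "f \<in> C0 \<Omega>" "g \<in> C0 \<Omega>"
  shows "\<mu> (\<lambda>x. a * f x + b * g x) = a * \<mu> f + b * \<mu> g"
proof -
  have "\<mu> (a *\<^sub>R f + b *\<^sub>R g) = a * \<mu> f + b * \<mu> g"
    using \<mu> f subspace_scale[OF subspace_C0, of _ \<Omega>]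
    by (simp add: radon_def dual_space_def linear_map_on_def)
  then show ?thesis by (simp add: plus_fun_def scaleR_fun_def)
qed

lemma radon_zero: "\<mu> \<in> radon \<Omega> \<Longrightarrow> \<mu> (\<lambda>x. 0) = 0"
  using radon_lincomb[of \<mu> \<Omega> 0 0 0 0] subspace_0[OF subspace_C0, of \<Omega>] by simp

lemma radon_sum:
  assumes \<mu>: "\<mu> \<in> radon \<Omega>" and I: "finite I" and f: "\<And>i. i \<in> I \<Longrightarrow> f i \<in> C0 \<Omega>"
  shows "\<mu> (\<Sum>i\<in>I. c i *\<^sub>R f i) = (\<Sum>i\<in>I. c i * \<mu> (f i))"
  using I f
proof (induction I)
  case empty
  then show ?case using radon_zero[OF \<mu>] by (simp add: zero_fun_def)
next
  case (insert i I)
  have "(\<Sum>i\<in>I. c i *\<^sub>R f i) \<in> C0 \<Omega>"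
    using insert.prems by (intro subspace_sum[OF subspace_C0] subspace_scale[OF subspace_C0]) blast
  then have "\<mu> (\<lambda>x. c i * f i x + 1 * (\<Sum>i\<in>I. c i *\<^sub>R f i) x) = c i * \<mu> (f i) + 1 * \<mu> (\<Sum>i\<in>I. c i *\<^sub>R f i)"
    using insert.prems by (intro radon_lincomb[OF \<mu>]) blast
  moreover have "(\<Sum>i\<in>insert i I. c i *\<^sub>R f i) = (\<lambda>x. c i * f i x + 1 * (\<Sum>i\<in>I. c i *\<^sub>R f i) x)"
    using insert.hyps by (simp add: plus_fun_def scaleR_fun_def)
  ultimately have "\<mu> (\<Sum>i\<in>insert i I. c i *\<^sub>R f i) = c i * \<mu> (f i) + 1 * \<mu> (\<Sum>i\<in>I. c i *\<^sub>R f i)"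
    by (simp only:)
  also have "\<mu> (\<Sum>i\<in>I. c i *\<^sub>R f i) = (\<Sum>i\<in>I. c i * \<mu> (f i))"
    using insert by blast
  finally show ?case
    using insert.hyps by simp
qed

lemma radon_bounded:
  assumes "\<mu> \<in> radon \<Omega>"
  obtains M where "M \<ge> 0" "\<And>f c. f \<in> C0 \<Omega> \<Longrightarrow> (\<And>x. \<bar>f x\<bar> \<le> c) \<Longrightarrow> \<bar>\<mu> f\<bar> \<le> M * c"
proof -
  obtain M where M: "\<And>f. f \<in> C0 \<Omega> \<Longrightarrow> \<bar>\<mu> f\<bar> \<le> M * sup_norm f"
    using assms by (auto simp: radon_def dual_space_def)
  have "\<bar>\<mu> f\<bar> \<le> max M 0 * c" if f: "f \<in> C0 \<Omega>" and c: "\<And>x. \<bar>f x\<bar> \<le> c" for f c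
  proof -
    have "\<bar>\<mu> f\<bar> \<le> max M 0 * sup_norm f"
      using M[OF f] mult_right_mono[OF max.cobounded1 C0_sup_norm_nonneg[OF f], of M 0] by linarith
    also have "\<dots> \<le> max M 0 * c"
      using sup_norm_le[OF c] by (intro mult_left_mono) simp_all
    finally show ?thesis .
  qed
  then show thesis by (intro that[of "max M 0"]) simp_all
qed

text \<open>Boundedness of \<open>\<mu>\<close>, in the form in which it is used: the kernel of \<open>\<mu>\<close> is closed under uniform
  limits.\<close>

lemma radon_eq_0_if_approximable:
  assumes \<mu>: "\<mu> \<in> radon \<Omega>" and f: "f \<in> C0 \<Omega>"
    and approx: "\<And>e. e > 0 \<Longrightarrow> \<exists>g\<in>C0 \<Omega>. \<mu> g = 0 \<and> (\<forall>x. \<bar>f x - g x\<bar> \<le> e)"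
  shows "\<mu> f = 0"
proof -
  obtain M where M: "M \<ge> 0" "\<And>f c. f \<in> C0 \<Omega> \<Longrightarrow> (\<And>x. \<bar>f x\<bar> \<le> c) \<Longrightarrow> \<bar>\<mu> f\<bar> \<le> M * c"
    using radon_bounded[OF \<mu>] by blast
  have "\<bar>\<mu> f\<bar> \<le> e" if e: "e > 0" for e
  proof -
    have "0 < e / (M + 1)" using e M(1) by simp
    then obtain g where g: "g \<in> C0 \<Omega>" "\<mu> g = 0" "\<And>x. \<bar>f x - g x\<bar> \<le> e / (M + 1)"
      using approx by blast
    have "\<mu> f = \<mu> (\<lambda>x. 1 * f x + (- 1) * g x)"
      unfolding radon_lincomb[OF \<mu> f g(1)] using g(2) by simp
    also have "\<bar>\<dots>\<bar> \<le> M * (e / (M + 1))"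
      using g(3) by (intro M(2) C0_lincomb f g(1)) simp
    also have "\<dots> \<le> e"
      using M(1) e by (simp add: field_simps)
    finally show ?thesis .
  qed
  then show ?thesis
    using field_le_epsilon[of "\<bar>\<mu> f\<bar>" 0] by simp
qed

lemma le_tv_norm:
  assumes \<mu>: "\<mu> \<in> radon \<Omega>" and f: "f \<in> C0 \<Omega>" "\<And>x. \<bar>f x\<bar> \<le> 1"
  shows "\<mu> f \<le> tv_norm \<Omega> \<mu>"
proof -
  obtain M where M: "\<And>f c. f \<in> C0 \<Omega> \<Longrightarrow> (\<And>x. \<bar>f x\<bar> \<le> c) \<Longrightarrow> \<bar>\<mu> f\<bar> \<le> M * c"
    using radon_bounded[OF \<mu>] by blast
  have "\<bar>\<mu> g\<bar> \<le> M" if "g \<in> C0 \<Omega>" "sup_norm g \<le> 1" for g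
    using M[OF that(1), of 1] order_trans[OF C0_le_sup_norm[OF that(1)] that(2)] by simp
  then have "bdd_above ((\<lambda>f. \<bar>\<mu> f\<bar>) ` {f \<in> C0 \<Omega>. sup_norm f \<le> 1})"
    by (auto intro!: bdd_aboveI2)
  then have "\<bar>\<mu> f\<bar> \<le> tv_norm \<Omega> \<mu>"
    unfolding tv_norm_def dual_norm_def using f(1) sup_norm_le[OF f(2)] by (intro cSUP_upper) simp_all
  then show ?thesis by simp
qed

lemma tv_norm_le:
  assumes \<mu>: "\<mu> \<in> radon \<Omega>"
    and le: "\<And>f. f \<in> C0 \<Omega> \<Longrightarrow> (\<And>x. \<bar>f x\<bar> \<le> 1) \<Longrightarrow> \<mu> f \<le> c"
  shows "tv_norm \<Omega> \<mu> \<le> c"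
  unfolding tv_norm_def dual_norm_def
proof (rule cSUP_least)
  show "{f \<in> C0 \<Omega>. sup_norm f \<le> 1} \<noteq> {}"
    using subspace_0[OF subspace_C0, of \<Omega>] by (auto simp: sup_norm_def zero_fun_def)
  fix f assume "f \<in> {f \<in> C0 \<Omega>. sup_norm f \<le> 1}"
  then have f: "f \<in> C0 \<Omega>" and f1: "sup_norm f \<le> 1" by auto
  have le1: "\<bar>f x\<bar> \<le> 1" for x
    using C0_le_sup_norm[OF f, of x] f1 by simp
  have "- \<mu> f = \<mu> (\<lambda>x. (- 1) * f x + 0 * f x)"
    unfolding radon_lincomb[OF \<mu> f f] by simp
  also have "\<dots> \<le> c"
    by (rule le[OF C0_lincomb[OF f f]]) (simp add: le1)
  finally show "\<bar>\<mu> f\<bar> \<le> c"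
    using le[OF f le1] by linarith
qed

lemma radon_eqI:
  assumes \<mu>: "\<mu> \<in> radon \<Omega>" and \<nu>: "\<nu> \<in> radon \<Omega>" and eq: "\<And>f. f \<in> C0 \<Omega> \<Longrightarrow> \<mu> f = \<nu> f"
  shows "\<mu> = \<nu>"
proof
  show "\<mu> f = \<nu> f" for f
    using \<mu> \<nu> eq by (cases "f \<in> C0 \<Omega>") (auto simp: radon_def dual_space_def)
qed

text \<open>This makes the operator into the measures well defined: test functions are dense, so a bounded
  functional is determined by its values on them.\<close>

lemma inj_on_measure_to_distribution:
  assumes \<Omega>: "open \<Omega>" and sub: "subspace (radon \<Omega>)"
  shows "inj_on (measure_to_distribution \<Omega>) (radon \<Omega>)"
proof (rule inj_onI)
  fix \<mu> \<nu> assume \<mu>: "\<mu> \<in> radon \<Omega>" and \<nu>: "\<nu> \<in> radon \<Omega>"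
    and eq: "measure_to_distribution \<Omega> \<mu> = measure_to_distribution \<Omega> \<nu>"
  define \<kappa> where "\<kappa> = \<mu> - \<nu>"
  have \<kappa>: "\<kappa> \<in> radon \<Omega>"
    unfolding \<kappa>_def by (rule subspace_diff[OF sub \<mu> \<nu>])
  have test0: "\<kappa> \<phi> = 0" if "\<phi> \<in> test_functions \<Omega>" for \<phi>
    using fun_cong[OF eq, of \<phi>] that by (simp add: measure_to_distribution_def \<kappa>_def)
  have subC: "subspace {g \<in> C0 \<Omega>. \<kappa> g = 0}"
    using radon_lincomb[OF \<kappa>, of _ _ 1 1] radon_lincomb[OF \<kappa>, of _ _ _ 0] radon_zero[OF \<kappa>]
      subspace_C0[of \<Omega>]
    by (auto simp: subspace_def plus_fun_def scaleR_fun_def zero_fun_def)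
  have span0: "\<phi> \<in> C0 \<Omega> \<and> \<kappa> \<phi> = 0" if "\<phi> \<in> span (test_functions \<Omega>)" for \<phi>
    using span_minimal[OF _ subC, of "test_functions \<Omega>"] test_functions_subset_C0 test0 that by blast
  have "\<kappa> f = 0" if "f \<in> C0 \<Omega>" for f
    by (rule radon_eq_0_if_approximable[OF \<kappa> that]) (metis test_functions_dense[OF \<Omega> that] span0)
  then show "\<mu> = \<nu>"
    by (intro radon_eqI[OF \<mu> \<nu>]) (simp add: \<kappa>_def)
qed

text \<open>The measure with density \<open>g\<close> with respect to \<open>\<mu>\<close>.\<close>

definition mult_measure :: "'a::euclidean_space set \<Rightarrow> ('a \<Rightarrow> real) \<Rightarrow> 'a functional \<Rightarrow> 'a functional" where
  "mult_measure \<Omega> g \<mu> = adjoint_on (C0 \<Omega>) (\<lambda>f x. g x * f x) \<mu>"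

lemma mult_measure_apply: "f \<in> C0 \<Omega> \<Longrightarrow> mult_measure \<Omega> g \<mu> f = \<mu> (\<lambda>x. g x * f x)"
  by (simp add: mult_measure_def adjoint_on_def)

lemma mult_measure_radon:
  assumes \<mu>: "\<mu> \<in> radon \<Omega>" and g: "g \<in> C0 \<Omega>"
  shows "mult_measure \<Omega> g \<mu> \<in> radon \<Omega>"
proof -
  obtain M where M: "M \<ge> 0" "\<And>f c. f \<in> C0 \<Omega> \<Longrightarrow> (\<And>x. \<bar>f x\<bar> \<le> c) \<Longrightarrow> \<bar>\<mu> f\<bar> \<le> M * c"
    using radon_bounded[OF \<mu>] by blast
  have "\<bar>mult_measure \<Omega> g \<mu> f\<bar> \<le> M * sup_norm g * sup_norm f" if f: "f \<in> C0 \<Omega>" for f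
    unfolding mult_measure_apply[OF f] mult.assoc
    using C0_le_sup_norm[OF f] C0_le_sup_norm[OF g] C0_sup_norm_nonneg[OF g]
    by (intro M(2) C0_mult g f) (auto simp: abs_mult intro!: mult_mono)
  moreover have "mult_measure \<Omega> g \<mu> (f + h) = mult_measure \<Omega> g \<mu> f + mult_measure \<Omega> g \<mu> h"
    if "f \<in> C0 \<Omega>" "h \<in> C0 \<Omega>" for f h
    using that radon_lincomb[OF \<mu> C0_mult[OF g that(1)] C0_mult[OF g that(2)], of 1 1]
      subspace_add[OF subspace_C0 that]
    by (simp add: mult_measure_apply distrib_left)
  moreover have "mult_measure \<Omega> g \<mu> (c *\<^sub>R f) = c *\<^sub>R mult_measure \<Omega> g \<mu> f" if "f \<in> C0 \<Omega>" for f c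
    using that radon_lincomb[OF \<mu> C0_mult[OF g that] C0_mult[OF g that], of c 0]
      subspace_scale[OF subspace_C0 that]
    by (simp add: mult_measure_apply scaleR_fun_def mult.left_commute)
  ultimately show ?thesis
    unfolding radon_def dual_space_def linear_map_on_def
    by (auto simp: mult_measure_def adjoint_on_def)
qed

section \<open>The support of a Radon measure\<close>

lemma supp_measure_iff:
  "x \<in> supp_measure \<Omega> \<mu> \<longleftrightarrow> x \<in> \<Omega> \<and> (\<forall>U. open U \<and> U \<subseteq> \<Omega> \<and> x \<in> U \<longrightarrow>
     (\<exists>f\<in>C0 \<Omega>. compact (closure {x. f x \<noteq> 0}) \<and> closure {x. f x \<noteq> 0} \<subseteq> U \<and> \<mu> f \<noteq> 0))"
  unfolding supp_measure_def by blast

text \<open>Off its support a measure is annihilated by the multiples of a bump. Together with the converse below,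
  this makes the support the common zero set of the ideal of all \<open>n\<close> with \<open>n \<mu> = 0\<close> in the algebra \<open>C0\<close>.\<close>

lemma annihilating_bump_off_supp:
  assumes "x \<in> \<Omega>" "x \<notin> supp_measure \<Omega> \<mu>"
  obtains n where "n \<in> C0 \<Omega>" "n x \<noteq> 0" "\<And>g. g \<in> C0 \<Omega> \<Longrightarrow> \<mu> (\<lambda>y. n y * g y) = 0"
proof -
  obtain U where U: "open U" "U \<subseteq> \<Omega>" "x \<in> U"
    and null: "\<And>f. f \<in> C0 \<Omega> \<Longrightarrow> compact (closure {x. f x \<noteq> 0}) \<Longrightarrow> closure {x. f x \<noteq> 0} \<subseteq> U \<Longrightarrow> \<mu> f = 0"
    using assms unfolding supp_measure_iff by blast
  obtain n where n: "n \<in> C0 \<Omega>" "n x = 1" "compact (closure {y. n y \<noteq> 0})" "closure {y. n y \<noteq> 0} \<subseteq> U"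
    using C0_bump[OF U] .
  have "\<mu> (\<lambda>y. n y * g y) = 0" if "g \<in> C0 \<Omega>" for g
  proof (rule null[OF C0_mult[OF n(1) that]])
    have sub: "closure {y. n y * g y \<noteq> 0} \<subseteq> closure {y. n y \<noteq> 0}"
      by (intro closure_mono) auto
    then show "closure {y. n y * g y \<noteq> 0} \<subseteq> U" using n(4) by blast
    show "compact (closure {y. n y * g y \<noteq> 0})"
      using compact_Int_closed[OF n(3) closed_closure[of "{y. n y * g y \<noteq> 0}"]] sub
      by (simp add: Int_absorb1)
  qed
  then show thesis using n by (intro that[of n]) simp_all
qed

text \<open>Near a point where \<open>f\<close> does not vanish, every compactly supported \<open>h\<close> is the multiple
  \<open>f (h / f)\<close> of \<open>f\<close>, so such a point has a null neighbourhood.\<close>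

lemma annihilator_vanishes_on_supp:
  assumes \<Omega>: "open \<Omega>" and f: "f \<in> C0 \<Omega>" and x: "x \<in> supp_measure \<Omega> \<mu>"
    and null: "\<And>g. g \<in> C0 \<Omega> \<Longrightarrow> \<mu> (\<lambda>y. f y * g y) = 0"
  shows "f x = 0"
proof (rule ccontr)
  assume fx: "f x \<noteq> 0"
  have cf: "continuous_on \<Omega> f" using f by (simp add: C0_def)
  define U where "U = \<Omega> \<inter> f -` (- {0})"
  have "open U"
    unfolding U_def by (rule continuous_open_preimage[OF cf \<Omega>]) (simp add: open_Compl)
  then obtain h where h: "h \<in> C0 \<Omega>" "compact (closure {x. h x \<noteq> 0})" "closure {x. h x \<noteq> 0} \<subseteq> U" "\<mu> h \<noteq> 0"
    using x fx unfolding supp_measure_iff U_def by (auto 4 4)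
  have h0: "h y = 0" if "y \<notin> closure {x. h x \<noteq> 0}" for y
    using that closure_subset[of "{x. h x \<noteq> 0}"] by blast
  have q: "(\<lambda>y. h y / f y) \<in> C0 \<Omega>"
    using h(3) by (intro C0_divide[OF \<Omega> cf h(1,2) _ h0]) (auto simp: U_def)
  have "h y = f y * (h y / f y)" for y
    using h0[of y] h(3) by (cases "f y = 0") (auto simp: U_def)
  then show False
    using null[OF q] h(4) by simp
qed

text \<open>The truncation \<open>g\<close> of \<open>f\<close> is supported in a compact set that misses the support of \<open>\<mu>\<close>. Finitely
  many annihilating bumps \<open>n c\<close> have no common zero on this set, so the sum \<open>N\<close> of their squares is
  positive there and \<open>g = N (g / N)\<close> lies in the ideal that \<open>\<mu>\<close> annihilates. Division by \<open>N\<close> replaces a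
  partition of unity.\<close>

lemma radon_eq_0_if_vanishes_on_supp:
  assumes \<Omega>: "open \<Omega>" and \<mu>: "\<mu> \<in> radon \<Omega>" and f: "f \<in> C0 \<Omega>"
    and f0: "\<And>x. x \<in> supp_measure \<Omega> \<mu> \<Longrightarrow> f x = 0"
  shows "\<mu> f = 0"
proof (rule radon_eq_0_if_approximable[OF \<mu> f])
  fix e :: real assume e: "e > 0"
  obtain g C where g: "g \<in> C0 \<Omega>" and C: "compact C" "C \<subseteq> \<Omega>" "\<And>x. x \<notin> C \<Longrightarrow> g x = 0"
    and fC: "\<And>x. x \<in> C \<Longrightarrow> f x \<noteq> 0" and fg: "\<And>x. \<bar>f x - g x\<bar> \<le> e"
    using C0_truncate[OF f e] by metis
  have "\<forall>c\<in>C. \<exists>n. n \<in> C0 \<Omega> \<and> n c \<noteq> 0 \<and> (\<forall>g\<in>C0 \<Omega>. \<mu> (\<lambda>y. n y * g y) = 0)"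
  proof
    fix c assume c: "c \<in> C"
    show "\<exists>n. n \<in> C0 \<Omega> \<and> n c \<noteq> 0 \<and> (\<forall>g\<in>C0 \<Omega>. \<mu> (\<lambda>y. n y * g y) = 0)"
      by (rule annihilating_bump_off_supp[of c \<Omega> \<mu>]) (use c fC f0 C(2) in blast)+
  qed
  from bchoice[OF this] obtain n where n: "\<And>c. c \<in> C \<Longrightarrow> n c \<in> C0 \<Omega>" "\<And>c. c \<in> C \<Longrightarrow> n c c \<noteq> 0"
    and null: "\<And>c g. c \<in> C \<Longrightarrow> g \<in> C0 \<Omega> \<Longrightarrow> \<mu> (\<lambda>y. n c y * g y) = 0"
    by blast
  have op: "open (\<Omega> \<inter> n c -` (- {0}))" if "c \<in> C" for c
    using n(1)[OF that] by (intro continuous_open_preimage \<Omega>) (simp_all add: C0_def open_Compl)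
  obtain I where I: "I \<subseteq> C" "finite I" "C \<subseteq> (\<Union>c\<in>I. \<Omega> \<inter> n c -` (- {0}))"
  proof (rule compactE_image[OF C(1), of C "\<lambda>c. \<Omega> \<inter> n c -` (- {0})"])
    show "C \<subseteq> (\<Union>c\<in>C. \<Omega> \<inter> n c -` (- {0}))"
      using C(2) n(2) by blast
  qed (use op in \<open>blast intro: that\<close>)+
  define N where "N = (\<Sum>c\<in>I. (\<lambda>x. n c x * n c x))"
  have N: "N \<in> C0 \<Omega>"
    unfolding N_def using n(1) I(1) by (intro subspace_sum[OF subspace_C0] C0_mult) blast+
  have N_pos: "N x \<noteq> 0" if x: "x \<in> C" for x
  proof -
    obtain c where c: "c \<in> I" "n c x \<noteq> 0" using I(3) x by blast
    then have "0 < n c x * n c x" by (auto simp: zero_less_mult_iff linorder_neq_iff)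
    then have "0 < N x"
      unfolding N_def sum_fun_apply using I(2) c(1) by (intro sum_pos2[of _ c]) simp_all
    then show ?thesis by simp
  qed
  define h where "h = (\<lambda>x. g x / N x)"
  have h: "h \<in> C0 \<Omega>"
    unfolding h_def using N N_pos by (intro C0_divide[OF \<Omega> _ g C]) (simp_all add: C0_def)
  have nh: "(\<lambda>x. n c x * (n c x * h x)) \<in> C0 \<Omega>" if "c \<in> I" for c
    using n(1) I(1) that by (intro C0_mult h) blast+
  have "g = (\<Sum>c\<in>I. (\<lambda>x. n c x * (n c x * h x)))"
  proof
    fix x
    have "g x = N x * h x"
      using N_pos C(3) by (cases "x \<in> C") (simp_all add: h_def)
    then show "g x = (\<Sum>c\<in>I. (\<lambda>x. n c x * (n c x * h x))) x"
      by (simp add: N_def sum_fun_apply sum_distrib_right mult.assoc)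
  qed
  then have "\<mu> g = (\<Sum>c\<in>I. 1 * \<mu> (\<lambda>x. n c x * (n c x * h x)))"
    using radon_sum[OF \<mu> I(2) nh, of "\<lambda>c. c" "\<lambda>_. 1"] by simp
  also have "\<dots> = 0"
    using I(1) n(1) by (intro sum.neutral ballI) (simp add: null C0_mult h subset_iff)
  finally have "\<mu> g = 0" .
  then show "\<exists>g\<in>C0 \<Omega>. \<mu> g = 0 \<and> (\<forall>x. \<bar>f x - g x\<bar> \<le> e)"
    using g fg by blast
qed

lemma dirac_apply: "f \<in> C0 \<Omega> \<Longrightarrow> dirac \<Omega> x f = f x"
  by (simp add: dirac_def)

text \<open>Interpolating \<open>f\<close> on \<open>F\<close> by bumps leaves a function that vanishes on the support, hence is
  annihilated; the coefficient at \<open>y\<close> is the value of \<open>\<mu>\<close> at the bump of \<open>y\<close>.\<close>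

lemma finite_supp_sum_dirac:
  assumes \<Omega>: "open \<Omega>" and sub: "subspace (radon \<Omega>)" and \<mu>: "\<mu> \<in> radon \<Omega>"
    and F: "finite F" "F \<subseteq> \<Omega>" "supp_measure \<Omega> \<mu> \<subseteq> F"
  obtains d where "\<mu> = (\<Sum>y\<in>F. d y *\<^sub>R dirac \<Omega> y)"
proof -
  obtain e where e: "\<And>y. y \<in> F \<Longrightarrow> e y \<in> C0 \<Omega>"
    "\<And>y z. y \<in> F \<Longrightarrow> z \<in> F \<Longrightarrow> e y z = (if y = z then 1 else (0::real))"
    using C0_separating_bumps[OF \<Omega> F(1,2)] by blast
  have "\<mu> = (\<Sum>y\<in>F. \<mu> (e y) *\<^sub>R dirac \<Omega> y)"
  proof (rule radon_eqI[OF \<mu>])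
    show "(\<Sum>y\<in>F. \<mu> (e y) *\<^sub>R dirac \<Omega> y) \<in> radon \<Omega>"
      by (intro subspace_sum[OF sub] subspace_scale[OF sub] dirac_radon)
    fix f assume f: "f \<in> C0 \<Omega>"
    define g where "g = (\<Sum>y\<in>F. f y *\<^sub>R e y)"
    have g: "g \<in> C0 \<Omega>"
      unfolding g_def using e(1) by (intro subspace_sum[OF subspace_C0] subspace_scale[OF subspace_C0])
    have "1 * f x + (- 1) * g x = 0" if "x \<in> supp_measure \<Omega> \<mu>" for x
    proof -
      have "x \<in> F" using that F(3) by blast
      then have "g x = (\<Sum>y\<in>F. if y = x then f y else 0)"
        unfolding g_def sum_fun_apply using e(2) by (intro sum.cong) (simp_all add: scaleR_fun_def)
      then show ?thesis using F(1) \<open>x \<in> F\<close> by simp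
    qed
    then have "\<mu> (\<lambda>x. 1 * f x + (- 1) * g x) = 0"
      by (rule radon_eq_0_if_vanishes_on_supp[OF \<Omega> \<mu> C0_lincomb[OF f g]])
    then have "\<mu> f = \<mu> g"
      using radon_lincomb[OF \<mu> f g, of 1 "- 1"] by simp
    then show "\<mu> f = (\<Sum>y\<in>F. \<mu> (e y) *\<^sub>R dirac \<Omega> y) f"
      using radon_sum[OF \<mu> F(1) e(1)] f
      by (simp add: g_def sum_fun_apply scaleR_fun_def dirac_apply mult.commute)
  qed
  then show thesis by (rule that)
qed

text \<open>A bump at \<open>x k\<close> that misses the other atoms picks out the coefficient \<open>d k\<close>.\<close>

lemma atom_in_supp:
  assumes I: "finite I" "inj_on x I" "x k \<in> \<Omega>" "k \<in> I" "d k \<noteq> 0"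
  shows "x k \<in> supp_measure \<Omega> (\<Sum>j\<in>I. d j *\<^sub>R dirac \<Omega> (x j))"
  unfolding supp_measure_iff
proof (intro conjI allI impI)
  show "x k \<in> \<Omega>" by fact
  fix U assume U: "open U \<and> U \<subseteq> \<Omega> \<and> x k \<in> U"
  have "x k \<in> U - x ` (I - {k})"
    using U I(2,4) by (auto simp: inj_on_def)
  moreover have "open (U - x ` (I - {k}))"
    using U I(1) by (intro open_Diff finite_imp_closed) auto
  moreover have "U - x ` (I - {k}) \<subseteq> \<Omega>" using U by blast
  ultimately obtain e where e: "e \<in> C0 \<Omega>" "e (x k) = 1" "compact (closure {y. e y \<noteq> 0})"
    "closure {y. e y \<noteq> 0} \<subseteq> U - x ` (I - {k})"
    using C0_bump[of "U - x ` (I - {k})" \<Omega> "x k"] by blast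
  have e0: "e (x j) = 0" if "j \<in> I - {k}" for j
    using e(4) closure_subset[of "{y. e y \<noteq> 0}"] that by blast
  have "(\<Sum>j\<in>I. d j *\<^sub>R dirac \<Omega> (x j)) e = (\<Sum>j\<in>I. d j * e (x j))"
    using e(1) by (simp add: sum_fun_apply scaleR_fun_def dirac_apply)
  also have "\<dots> = d k"
    using I(1,4) e(2) e0 by (simp add: sum.remove)
  finally show "\<exists>f\<in>C0 \<Omega>. compact (closure {x. f x \<noteq> 0}) \<and> closure {x. f x \<noteq> 0} \<subseteq> U \<and>
      (\<Sum>j\<in>I. d j *\<^sub>R dirac \<Omega> (x j)) f \<noteq> 0"
    using e I(5) by (intro bexI[of _ e]) auto
qed

section \<open>Measures that attain their norm\<close>

text \<open>Where \<open>\<bar>\<zeta>\<bar> < 1\<close> there is room to add a small multiple of any function \<open>f\<close> supported nearby without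
  leaving the unit ball. Since \<open>\<mu>\<close> is maximal at \<open>\<zeta>\<close> over the unit ball, \<open>\<mu> f\<close> has to vanish.\<close>

lemma supp_subset_norming_set:
  assumes \<Omega>: "open \<Omega>" and \<mu>: "\<mu> \<in> radon \<Omega>"
    and \<zeta>: "\<zeta> \<in> C0 \<Omega>" "\<And>x. \<bar>\<zeta> x\<bar> \<le> 1" "tv_norm \<Omega> \<mu> \<le> \<mu> \<zeta>"
  shows "supp_measure \<Omega> \<mu> \<subseteq> {x \<in> \<Omega>. \<bar>\<zeta> x\<bar> = 1}"
proof (rule subsetI, rule ccontr)
  fix x assume x: "x \<in> supp_measure \<Omega> \<mu>" and "x \<notin> {x \<in> \<Omega>. \<bar>\<zeta> x\<bar> = 1}"
  then have x\<Omega>: "x \<in> \<Omega>" and lt: "\<bar>\<zeta> x\<bar> < 1"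
    using \<zeta>(2)[of x] by (auto simp: supp_measure_def)
  define \<delta> where "\<delta> = (1 - \<bar>\<zeta> x\<bar>) / 2"
  have \<delta>: "\<delta> > 0" using lt by (simp add: \<delta>_def)
  define U where "U = \<Omega> \<inter> \<zeta> -` {- (1 - \<delta>) <..< 1 - \<delta>}"
  have "open U"
    unfolding U_def using \<zeta>(1) by (intro continuous_open_preimage \<Omega>) (simp_all add: C0_def)
  moreover have "x \<in> U"
    using x\<Omega> lt by (auto simp: U_def \<delta>_def abs_if field_simps split: if_splits)
  ultimately obtain f where f: "f \<in> C0 \<Omega>" "closure {x. f x \<noteq> 0} \<subseteq> U" "\<mu> f \<noteq> 0"
    using x unfolding supp_measure_iff U_def by blast
  \<comment> \<open>The sign lets the perturbation increase the value of \<open>\<mu>\<close>; the size keeps it below \<open>\<delta>\<close>.\<close>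
  define c where "c = sgn (\<mu> f) * (\<delta> / (sup_norm f + 1))"
  have "\<bar>1 * \<zeta> y + c * f y\<bar> \<le> 1" for y
  proof (cases "f y = 0")
    case True
    then show ?thesis using \<zeta>(2) by simp
  next
    case False
    then have "\<bar>\<zeta> y\<bar> < 1 - \<delta>"
      using f(2) closure_subset[of "{x. f x \<noteq> 0}"] by (force simp: U_def)
    moreover have "\<bar>c * f y\<bar> \<le> \<delta> / (sup_norm f + 1) * (sup_norm f + 1)"
      unfolding abs_mult
      using C0_le_sup_norm[OF f(1), of y] C0_sup_norm_nonneg[OF f(1)] \<delta> f(3)
      by (intro mult_mono) (simp_all add: c_def abs_mult abs_sgn_eq)
    then have "\<bar>c * f y\<bar> \<le> \<delta>"
      using C0_sup_norm_nonneg[OF f(1)] nonzero_divide_eq_eq[of "sup_norm f + 1"] by fastforce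
    ultimately show ?thesis by linarith
  qed
  then have "\<mu> (\<lambda>y. 1 * \<zeta> y + c * f y) \<le> tv_norm \<Omega> \<mu>"
    by (intro le_tv_norm[OF \<mu>] C0_lincomb \<zeta>(1) f(1))
  then have "c * \<mu> f \<le> 0"
    using \<zeta>(3) unfolding radon_lincomb[OF \<mu> \<zeta>(1) f(1)] by simp
  moreover have "c * \<mu> f = \<bar>\<mu> f\<bar> * (\<delta> / (sup_norm f + 1))"
    unfolding c_def by (simp add: abs_sgn mult_ac)
  moreover have "0 < \<bar>\<mu> f\<bar> * (\<delta> / (sup_norm f + 1))"
    using f(3) \<delta> C0_sup_norm_nonneg[OF f(1)] by (intro mult_pos_pos) simp_all
  ultimately show False by linarith
qed

text \<open>Heuristically \<open>\<zeta>\<close> is the sign of \<open>\<mu>\<close>, so that a nonnegative density \<open>1 + g\<close> changes the total variation to the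
  integral of \<open>(1 + g) \<zeta>\<close>, an affine function of \<open>g\<close>. The proof avoids signs: with \<open>h = (1 + g) / 2\<close>
  the pointwise convex combination \<open>h f + (1 - h) \<zeta>\<close> stays in the unit ball, over which \<open>\<mu>\<close> is maximal at \<open>\<zeta>\<close>.\<close>

lemma tv_norm_reweight_le:
  assumes sub: "subspace (radon \<Omega>)" and \<mu>: "\<mu> \<in> radon \<Omega>"
    and \<zeta>: "\<zeta> \<in> C0 \<Omega>" "\<And>x. \<bar>\<zeta> x\<bar> \<le> 1" "tv_norm \<Omega> \<mu> \<le> \<mu> \<zeta>"
    and g: "g \<in> C0 \<Omega>" "\<And>x. \<bar>g x\<bar> \<le> 1"
  shows "tv_norm \<Omega> (\<mu> + mult_measure \<Omega> g \<mu>) \<le> \<mu> \<zeta> + \<mu> (\<lambda>x. g x * \<zeta> x)"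
proof (rule tv_norm_le)
  show "\<mu> + mult_measure \<Omega> g \<mu> \<in> radon \<Omega>"
    by (intro subspace_add[OF sub] \<mu> mult_measure_radon g)
  fix f assume f: "f \<in> C0 \<Omega>" "\<And>x. \<bar>f x\<bar> \<le> 1"
  define k1 where "k1 x = 1/2 * f x + 1/2 * (g x * f x)" for x
  define k2 where "k2 x = 1/2 * \<zeta> x + (- 1/2) * (g x * \<zeta> x)" for x
  have k1: "k1 \<in> C0 \<Omega>" "\<mu> k1 = 1/2 * \<mu> f + 1/2 * \<mu> (\<lambda>x. g x * f x)"
    unfolding k1_def by (intro C0_lincomb radon_lincomb[OF \<mu>] C0_mult f g)+
  have k2: "k2 \<in> C0 \<Omega>" "\<mu> k2 = 1/2 * \<mu> \<zeta> + (- 1/2) * \<mu> (\<lambda>x. g x * \<zeta> x)"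
    unfolding k2_def by (intro C0_lincomb radon_lincomb[OF \<mu>] C0_mult \<zeta> g)+
  have "\<bar>1 * k1 x + 1 * k2 x\<bar> \<le> 1" for x
  proof -
    define h where "h = (1 + g x) / 2"
    have h: "0 \<le> h" "0 \<le> 1 - h" using g(2)[of x] by (auto simp: h_def abs_le_iff)
    have "1 * k1 x + 1 * k2 x = h * f x + (1 - h) * \<zeta> x"
      by (simp add: k1_def k2_def h_def field_simps)
    also have "\<bar>\<dots>\<bar> \<le> h * \<bar>f x\<bar> + (1 - h) * \<bar>\<zeta> x\<bar>"
      using h by (intro order_trans[OF abs_triangle_ineq]) (simp add: abs_mult)
    also have "\<dots> \<le> h * 1 + (1 - h) * 1"
      by (intro add_mono mult_left_mono h f(2) \<zeta>(2))
    finally show ?thesis by simp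
  qed
  then have "\<mu> (\<lambda>x. 1 * k1 x + 1 * k2 x) \<le> tv_norm \<Omega> \<mu>"
    by (intro le_tv_norm[OF \<mu>] C0_lincomb k1 k2)
  then have "\<mu> f + \<mu> (\<lambda>x. g x * f x) \<le> \<mu> \<zeta> + \<mu> (\<lambda>x. g x * \<zeta> x)"
    using \<zeta>(3) unfolding radon_lincomb[OF \<mu> k1(1) k2(1)] k1(2) k2(2) by simp
  then show "(\<mu> + mult_measure \<Omega> g \<mu>) f \<le> \<mu> \<zeta> + \<mu> (\<lambda>x. g x * \<zeta> x)"
    using f(1) by (simp add: mult_measure_apply)
qed

section \<open>Linear maps given on a carrier\<close>

lemma linear_map_on_add: "linear_map_on S T \<Longrightarrow> x \<in> S \<Longrightarrow> y \<in> S \<Longrightarrow> T (x + y) = T x + T y"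
  and linear_map_on_scale: "linear_map_on S T \<Longrightarrow> x \<in> S \<Longrightarrow> T (c *\<^sub>R x) = c *\<^sub>R T x"
  by (simp_all add: linear_map_on_def)

lemma linear_map_on_0: "linear_map_on S T \<Longrightarrow> subspace S \<Longrightarrow> T 0 = 0"
  using linear_map_on_scale[of S T 0 0] subspace_0[of S] by simp

lemma linear_map_on_diff:
  assumes "linear_map_on S T" "subspace S" "x \<in> S" "y \<in> S"
  shows "T (x - y) = T x - T y"
proof -
  have "T (x + (- 1) *\<^sub>R y) = T x + (- 1) *\<^sub>R T y"
    using assms by (simp only: linear_map_on_add linear_map_on_scale subspace_scale)
  then show ?thesis by simp
qed

lemma linear_map_on_sum:
  assumes T: "linear_map_on S T" and S: "subspace S" and x: "\<And>i. i \<in> I \<Longrightarrow> x i \<in> S"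
  shows "T (\<Sum>i\<in>I. c i *\<^sub>R x i) = (\<Sum>i\<in>I. c i *\<^sub>R T (x i))"
  using x
proof (induction I rule: infinite_finite_induct)
  case (insert i I)
  have "(\<Sum>i\<in>I. c i *\<^sub>R x i) \<in> S"
    using insert.prems by (intro subspace_sum[OF S] subspace_scale[OF S]) blast
  then show ?case
    using insert by (simp add: linear_map_on_add[OF T] linear_map_on_scale[OF T] subspace_scale[OF S])
qed (simp_all add: linear_map_on_0[OF T S])

lemma subspace_kernel_on:
  assumes "linear_map_on S T" "subspace S"
  shows "subspace (kernel_on S T)"
  using assms linear_map_on_0[OF assms] by (simp add: subspace_def kernel_on_def linear_map_on_def)

lemma subspace_linear_map_on_image:
  assumes T: "linear_map_on S T" and "U \<subseteq> S" "subspace U"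
  shows "subspace (T ` U)"
  unfolding subspace_def
proof (intro conjI ballI allI)
  have U: "linear_map_on U T" using T \<open>U \<subseteq> S\<close> unfolding linear_map_on_def by blast
  show "0 \<in> T ` U"
    using linear_map_on_0[OF U assms(3)] subspace_0[OF assms(3)] by (metis image_eqI)
  show "x + y \<in> T ` U" if "x \<in> T ` U" "y \<in> T ` U" for x y
    using that linear_map_on_add[OF U] subspace_add[OF assms(3)] by (metis (no_types, lifting) imageE image_eqI)
  show "c *\<^sub>R x \<in> T ` U" if "x \<in> T ` U" for x c
    using that linear_map_on_scale[OF U] subspace_scale[OF assms(3)] by (metis (no_types, lifting) imageE image_eqI)
qed

text \<open>If \<open>T\<close> is surjective, the complement \<open>W\<close> of its range is trivial, and the pseudoinverse is the inverse of
  the restriction of \<open>T\<close> to \<open>V\<close>.\<close>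

lemma pseudoinverse_surjective:
  assumes T: "linear_map_on S T" and S: "subspace S"
    and V: "direct_sum (kernel_on S T) V S" and W: "direct_sum (T ` S) W (T ` S)"
  defines "P \<equiv> pseudoinverse S V W T"
  shows "\<And>y. y \<in> T ` S \<Longrightarrow> P y \<in> S" "\<And>y. y \<in> T ` S \<Longrightarrow> T (P y) = y" "linear_map_on (T ` S) P"
proof -
  have subV: "subspace V" and kerV: "kernel_on S T \<inter> V = {0}"
    and sum: "{u + v |u v. u \<in> kernel_on S T \<and> v \<in> V} = S"
    using V by (auto simp: direct_sum_def)
  have VS: "V \<subseteq> S"
  proof
    fix v assume "v \<in> V"
    then have "0 + v \<in> {u + v |u v. u \<in> kernel_on S T \<and> v \<in> V}"
      using subspace_0[OF subspace_kernel_on[OF T S]] by blast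
    then show "v \<in> S" using sum by simp
  qed
  have "W = {0}"
  proof -
    have subW: "subspace W" and "subspace (T ` S)" and int: "T ` S \<inter> W = {0}"
      and sum: "{u + v |u v. u \<in> T ` S \<and> v \<in> W} = T ` S"
      using W by (auto simp: direct_sum_def)
    have "w \<in> T ` S" if "w \<in> W" for w
    proof -
      have "0 + w \<in> {u + v |u v. u \<in> T ` S \<and> v \<in> W}"
        using subspace_0[OF \<open>subspace (T ` S)\<close>] that by blast
      then show ?thesis using sum by simp
    qed
    then show ?thesis using int by blast
  qed
  then have "proj_along (T ` S) W y = y" if "y \<in> T ` S" for y
    unfolding proj_along_def using that by (intro the_equality) auto
  then have P: "P y = the_inv_into V T y" if "y \<in> T ` S" for y
    using that by (simp add: P_def pseudoinverse_def)
  have inj: "inj_on T V"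
  proof (rule inj_onI)
    fix v w assume vw: "v \<in> V" "w \<in> V" "T v = T w"
    then have "v - w \<in> kernel_on S T \<inter> V"
      using VS linear_map_on_diff[OF T S, of v w] subspace_diff[OF S] subspace_diff[OF subV]
      by (auto simp: kernel_on_def)
    then show "v = w" using kerV by simp
  qed
  have TV: "T ` S \<subseteq> T ` V"
  proof
    fix y assume "y \<in> T ` S"
    then obtain x where x: "x \<in> S" "y = T x" by blast
    then have "x \<in> {u + v |u v. u \<in> kernel_on S T \<and> v \<in> V}"
      using sum by simp
    then obtain k v where kv: "k \<in> S" "T k = 0" "v \<in> V" "x = k + v"
      by (auto simp: kernel_on_def)
    then have "y = T v"
      using x(2) VS linear_map_on_add[OF T kv(1), of v] by auto
    then show "y \<in> T ` V" using kv(3) by blast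
  qed
  have PV: "P y \<in> V" and TP: "T (P y) = y" if "y \<in> T ` S" for y
    unfolding P[OF that] using that TV
    by (blast intro: the_inv_into_into[OF inj _ subset_refl] f_the_inv_into_f[OF inj])+
  show "P y \<in> S" and "T (P y) = y" if "y \<in> T ` S" for y
    using PV[OF that] TP[OF that] VS by auto
  have subR: "subspace (T ` S)"
    by (rule subspace_linear_map_on_image[OF T subset_refl S])
  have P_eqI: "P y = v" if "v \<in> V" "T v = y" for v y
    using that VS inj P[of y] by (auto simp: the_inv_into_f_eq)
  show "linear_map_on (T ` S) P"
    unfolding linear_map_on_def
  proof (intro conjI ballI allI)
    fix y z assume yz: "y \<in> T ` S" "z \<in> T ` S"
    show "P (y + z) = P y + P z"
      using yz PV VS TP linear_map_on_add[OF T, of "P y" "P z"]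
      by (intro P_eqI subspace_add[OF subV]) (auto simp: subset_iff)
  next
    fix c y assume y: "y \<in> T ` S"
    show "P (c *\<^sub>R y) = c *\<^sub>R P y"
      using y PV VS TP linear_map_on_scale[OF T, of "P y" c]
      by (intro P_eqI subspace_scale[OF subV]) (auto simp: subset_iff)
  qed
qed

text \<open>Linear dependence modulo \<open>D\<close>, by counting dimensions. It is stated for families, as the vectors \<open>w y\<close>
  may coincide; adding them to \<open>D\<close> one at a time replaces the passage to the quotient space.\<close>

lemma nontrivial_combination_in_span:
  fixes w :: "'b \<Rightarrow> 'w::euclidean_space"
  assumes "finite F" "DIM('w) < dim D + card F"
  shows "\<exists>t. (\<exists>y\<in>F. t y \<noteq> 0) \<and> (\<Sum>y\<in>F. t y *\<^sub>R w y) \<in> span D"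
  using assms
proof (induction F arbitrary: D)
  case empty
  then show ?case using dim_subset_UNIV[of D] by simp
next
  case (insert y F)
  show ?case
  proof (cases "w y \<in> span D")
    case True
    have "(\<Sum>z\<in>insert y F. (if z = y then 1 else 0) *\<^sub>R w z) = w y"
      using insert.hyps by (simp add: if_distrib[of "\<lambda>c. c *\<^sub>R _"] cong: if_cong)
    then show ?thesis using True by (intro exI[of _ "\<lambda>z. if z = y then 1 else 0"]) simp
  next
    case False
    then have "DIM('w) < dim (insert (w y) D) + card F"
      using insert.prems insert.hyps by (simp add: dim_insert)
    then obtain t where t: "\<exists>z\<in>F. t z \<noteq> 0" "(\<Sum>z\<in>F. t z *\<^sub>R w z) \<in> span (insert (w y) D)"
      using insert.IH by blast
    then obtain k where k: "(\<Sum>z\<in>F. t z *\<^sub>R w z) - k *\<^sub>R w y \<in> span D"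
      using span_breakdown_eq by blast
    have "(\<Sum>z\<in>insert y F. (t(y := - k)) z *\<^sub>R w z) = (\<Sum>z\<in>F. t z *\<^sub>R w z) - k *\<^sub>R w y"
    proof -
      have "(\<Sum>z\<in>F. (t(y := - k)) z *\<^sub>R w z) = (\<Sum>z\<in>F. t z *\<^sub>R w z)"
        using insert.hyps by (intro sum.cong) auto
      then show ?thesis using insert.hyps by simp
    qed
    then show ?thesis
      using t(1) k insert.hyps by (intro exI[of _ "t(y := - k)"]) auto
  qed
qed

section \<open>Sparsity of unique solutions\<close>

text \<open>Suppose the number of points in the support of \<open>\<mu> = T u\<close> exceeds the codimension of \<open>A (ker T)\<close>. Take a bump \<open>e y\<close> at each of these points. Some nontrivial combination \<open>g\<close>
  of the bumps satisfies \<open>A (P (g \<mu>)) = A k\<close> with \<open>k\<close> in the kernel of \<open>T\<close>, so that \<open>A\<close> does not change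
  along \<open>w = P (g \<mu>) - k\<close>. The total variation of \<open>T (u + r w) = (1 + r g) \<mu>\<close> is bounded by an affine
  function of \<open>r\<close> that is exact at \<open>r = 0\<close>, hence it does not increase for one of the two signs of \<open>r\<close>.
  Uniqueness forces \<open>g \<mu> = 0\<close>, but \<open>g\<close> does not vanish at some point of the support.\<close>

lemma card_supp_le_if_unique:
  fixes A :: "'v::real_vector \<Rightarrow> 'w::euclidean_space" and T :: "'v \<Rightarrow> 'a::euclidean_space functional"
  assumes \<Omega>: "open \<Omega>" and sub: "subspace (radon \<Omega>)"
    and S: "subspace S" and T: "linear_map_on S T" and A: "linear_map_on S A"
    and P: "\<And>\<mu>. \<mu> \<in> radon \<Omega> \<Longrightarrow> P \<mu> \<in> S" "\<And>\<mu>. \<mu> \<in> radon \<Omega> \<Longrightarrow> T (P \<mu>) = \<mu>" "linear_map_on (radon \<Omega>) P"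
    and u: "u \<in> S" "T u \<in> radon \<Omega>"
    and \<zeta>: "\<zeta> \<in> C0 \<Omega>" "\<And>x. \<bar>\<zeta> x\<bar> \<le> 1" "tv_norm \<Omega> (T u) \<le> T u \<zeta>"
    and unique: "\<And>v. v \<in> S \<Longrightarrow> A v = A u \<Longrightarrow> tv_norm \<Omega> (T v) \<le> tv_norm \<Omega> (T u) \<Longrightarrow> v = u"
  shows "finite (supp_measure \<Omega> (T u)) \<and>
    card (supp_measure \<Omega> (T u)) \<le> DIM('w) - dim (A ` kernel_on S T)"
proof (rule ccontr)
  define \<mu> where "\<mu> = T u"
  define D where "D = A ` kernel_on S T"
  note \<mu> = u(2)[folded \<mu>_def]
  assume "\<not> ?thesis"
  then have "infinite (supp_measure \<Omega> \<mu>) \<or> DIM('w) - dim D < card (supp_measure \<Omega> \<mu>)"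
    unfolding \<mu>_def D_def by auto
  then obtain F where F: "F \<subseteq> supp_measure \<Omega> \<mu>" "finite F" "card F = Suc (DIM('w) - dim D)"
    using infinite_arbitrarily_large[of "supp_measure \<Omega> \<mu>" "Suc (DIM('w) - dim D)"]
      obtain_subset_with_card_n[of "Suc (DIM('w) - dim D)" "supp_measure \<Omega> \<mu>"]
    by (metis Suc_leI)
  have F\<Omega>: "F \<subseteq> \<Omega>" using F(1) by (auto simp: supp_measure_def)
  obtain e where e: "\<And>y. y \<in> F \<Longrightarrow> e y \<in> C0 \<Omega>"
    "\<And>y z. y \<in> F \<Longrightarrow> z \<in> F \<Longrightarrow> e y z = (if y = z then 1 else (0::real))"
    using C0_separating_bumps[OF \<Omega> F(2) F\<Omega>] by blast
  have subK: "subspace (kernel_on S T)"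
    by (rule subspace_kernel_on[OF T S])
  have subD: "subspace D"
    unfolding D_def by (rule subspace_linear_map_on_image[OF A _ subK]) (auto simp: kernel_on_def)
  have "DIM('w) < dim D + card F"
    using F(3) by simp
  then obtain t where t: "\<exists>y\<in>F. t y \<noteq> 0"
    and tD: "(\<Sum>y\<in>F. t y *\<^sub>R A (P (mult_measure \<Omega> (e y) \<mu>))) \<in> D"
    using nontrivial_combination_in_span[OF F(2), of D "\<lambda>y. A (P (mult_measure \<Omega> (e y) \<mu>))"]
      span_eq_iff[THEN iffD2, OF subD] by auto
  define g where "g = (\<Sum>y\<in>F. t y *\<^sub>R e y)"
  have g: "g \<in> C0 \<Omega>"
    unfolding g_def using e(1) by (intro subspace_sum[OF subspace_C0] subspace_scale[OF subspace_C0])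
  define \<nu> where "\<nu> = mult_measure \<Omega> g \<mu>"
  have \<nu>: "\<nu> \<in> radon \<Omega>"
    unfolding \<nu>_def by (rule mult_measure_radon[OF \<mu> g])
  have e\<mu>: "mult_measure \<Omega> (e y) \<mu> \<in> radon \<Omega>" if "y \<in> F" for y
    by (rule mult_measure_radon[OF \<mu> e(1)[OF that]])
  have \<nu>_sum: "\<nu> = (\<Sum>y\<in>F. t y *\<^sub>R mult_measure \<Omega> (e y) \<mu>)"
  proof (rule radon_eqI[OF \<nu>])
    show "(\<Sum>y\<in>F. t y *\<^sub>R mult_measure \<Omega> (e y) \<mu>) \<in> radon \<Omega>"
      using e\<mu> by (intro subspace_sum[OF sub] subspace_scale[OF sub])
    fix f assume f: "f \<in> C0 \<Omega>"
    have "(\<lambda>x. g x * f x) = (\<Sum>y\<in>F. t y *\<^sub>R (\<lambda>x. e y x * f x))"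
      by (simp add: fun_eq_iff g_def sum_fun_apply scaleR_fun_def sum_distrib_right mult.assoc)
    then show "\<nu> f = (\<Sum>y\<in>F. t y *\<^sub>R mult_measure \<Omega> (e y) \<mu>) f"
      using f radon_sum[OF \<mu> F(2) C0_mult[OF e(1) f], of "\<lambda>y. y" t]
      by (simp add: \<nu>_def mult_measure_apply sum_fun_apply scaleR_fun_def)
  qed
  have "A (P \<nu>) \<in> D"
  proof -
    have "P \<nu> = (\<Sum>y\<in>F. t y *\<^sub>R P (mult_measure \<Omega> (e y) \<mu>))"
      unfolding \<nu>_sum by (rule linear_map_on_sum[OF P(3) sub e\<mu>])
    also have "A \<dots> = (\<Sum>y\<in>F. t y *\<^sub>R A (P (mult_measure \<Omega> (e y) \<mu>)))"
      by (rule linear_map_on_sum[OF A S P(1)[OF e\<mu>]])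
    finally show ?thesis using tD by simp
  qed
  then obtain k where k: "k \<in> S" "T k = 0" "A k = A (P \<nu>)"
    unfolding D_def kernel_on_def by auto
  define w where "w = P \<nu> - k"
  have w: "w \<in> S" "A w = 0" "T w = \<nu>"
    using k P(1,2)[OF \<nu>] linear_map_on_diff[OF A S P(1)[OF \<nu>] k(1)] linear_map_on_diff[OF T S P(1)[OF \<nu>] k(1)]
      subspace_diff[OF S] by (simp_all add: w_def)
  \<comment> \<open>The denominator makes \<open>\<bar>r g\<bar> \<le> 1\<close>, so that the density \<open>1 + r g\<close> is nonnegative.\<close>
  define r where "r = (if \<mu> (\<lambda>x. g x * \<zeta> x) \<le> 0 then 1 else - 1) / (sup_norm g + 1)"
  have gpos: "0 < sup_norm g + 1" using C0_sup_norm_nonneg[OF g] by simp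
  have r: "r \<noteq> 0" "r * \<mu> (\<lambda>x. g x * \<zeta> x) \<le> 0"
    using gpos by (simp_all add: r_def divide_nonpos_pos)
  have rg: "\<bar>(r *\<^sub>R g) x\<bar> \<le> 1" for x
    using C0_le_sup_norm[OF g, of x] gpos by (simp add: r_def scaleR_fun_def abs_mult)
  have rgC0: "r *\<^sub>R g \<in> C0 \<Omega>"
    by (rule subspace_scale[OF subspace_C0 g])
  have "tv_norm \<Omega> (T (u + r *\<^sub>R w)) \<le> tv_norm \<Omega> (T u)"
  proof -
    have "mult_measure \<Omega> (r *\<^sub>R g) \<mu> = r *\<^sub>R \<nu>"
    proof (rule radon_eqI[OF mult_measure_radon[OF \<mu> rgC0] subspace_scale[OF sub \<nu>]])
      fix f assume f: "f \<in> C0 \<Omega>"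
      show "mult_measure \<Omega> (r *\<^sub>R g) \<mu> f = (r *\<^sub>R \<nu>) f"
        using f radon_lincomb[OF \<mu> C0_mult[OF g f] C0_mult[OF g f], of r 0]
        by (simp add: \<nu>_def mult_measure_apply scaleR_fun_def mult.assoc)
    qed
    then have Tv: "T (u + r *\<^sub>R w) = \<mu> + mult_measure \<Omega> (r *\<^sub>R g) \<mu>"
      using u(1) w subspace_scale[OF S w(1)]
      by (simp add: linear_map_on_add[OF T] linear_map_on_scale[OF T] \<mu>_def)
    have "tv_norm \<Omega> (T (u + r *\<^sub>R w)) \<le> \<mu> \<zeta> + \<mu> (\<lambda>x. (r *\<^sub>R g) x * \<zeta> x)"
      using \<zeta> rg unfolding Tv by (intro tv_norm_reweight_le[OF sub \<mu> _ _ _ rgC0]) (simp_all add: \<mu>_def)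
    also have "\<dots> = \<mu> \<zeta> + r * \<mu> (\<lambda>x. g x * \<zeta> x)"
      using radon_lincomb[OF \<mu> C0_mult[OF g \<zeta>(1)] C0_mult[OF g \<zeta>(1)], of r 0]
      by (simp add: scaleR_fun_def mult.assoc)
    also have "\<dots> \<le> tv_norm \<Omega> \<mu>"
      using r(2) le_tv_norm[OF \<mu> \<zeta>(1,2)] by simp
    finally show ?thesis by (simp add: \<mu>_def)
  qed
  moreover have "A (u + r *\<^sub>R w) = A u"
    using u(1) w subspace_scale[OF S w(1)] by (simp add: linear_map_on_add[OF A] linear_map_on_scale[OF A])
  ultimately have "u + r *\<^sub>R w = u"
    using u(1) w(1) by (intro unique subspace_add[OF S] subspace_scale[OF S])
  then have "w = 0" using r(1) by simp
  then have "\<nu> = 0" using w(3) linear_map_on_0[OF T S] by simp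
  then have null: "\<mu> (\<lambda>x. g x * f x) = 0" if "f \<in> C0 \<Omega>" for f
    using mult_measure_apply[OF that, of g \<mu>] by (simp add: \<nu>_def)
  obtain y where y: "y \<in> F" "t y \<noteq> 0" using t by blast
  have "g y = 0"
    using F(1) y(1) null by (intro annihilator_vanishes_on_supp[of \<Omega> g y \<mu>] \<Omega> g) blast+
  moreover have "g y = (\<Sum>z\<in>F. if z = y then t z else 0)"
    unfolding g_def sum_fun_apply using e(2) y(1) by (intro sum.cong) (simp_all add: scaleR_fun_def)
  ultimately show False using F(2) y by simp
qed

section \<open>Primal-dual pairs\<close>

text \<open>Linearity gives the certificate explicitly as the sum of the \<open>q $ i *\<^sub>R \<rho> i\<close>, so the definite description
  behind it denotes.\<close>

lemma certificate_represents:
  assumes S: "S = B_space \<Omega> L nK" and a: "\<And>i. represents \<Omega> (\<rho> i) (adjoint_on (radon \<Omega>) (L_pinv \<Omega> L nK V W) (a i))"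
    and P: "\<And>\<mu>. \<mu> \<in> radon \<Omega> \<Longrightarrow> L_pinv \<Omega> L nK V W \<mu> \<in> S"
  shows "represents \<Omega> (certificate \<Omega> L nK V W a q)
    (adjoint_on (radon \<Omega>) (L_pinv \<Omega> L nK V W) (measurement_adjoint S a q))"
proof -
  have \<rho>: "\<rho> i \<in> C0 \<Omega>" "\<mu> \<in> radon \<Omega> \<Longrightarrow> a i (L_pinv \<Omega> L nK V W \<mu>) = \<mu> (\<rho> i)" for i \<mu>
    using a[of i] by (auto simp: represents_def adjoint_on_def)
  have "(\<Sum>i\<in>UNIV. q $ i *\<^sub>R \<rho> i) \<in> C0 \<Omega>"
    by (intro subspace_sum[OF subspace_C0] subspace_scale[OF subspace_C0] \<rho>)
  moreover have "adjoint_on (radon \<Omega>) (L_pinv \<Omega> L nK V W) (measurement_adjoint S a q) \<mu>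
      = \<mu> (\<Sum>i\<in>UNIV. q $ i *\<^sub>R \<rho> i)" if "\<mu> \<in> radon \<Omega>" for \<mu>
    using that P[OF that] radon_sum[OF that, of UNIV \<rho> "\<lambda>i. q $ i"]
    by (simp add: adjoint_on_def measurement_adjoint_def measurement_def inner_vec_def \<rho>)
  ultimately have sum: "represents \<Omega> (\<Sum>i\<in>UNIV. q $ i *\<^sub>R \<rho> i)
      (adjoint_on (radon \<Omega>) (L_pinv \<Omega> L nK V W) (measurement_adjoint S a q))"
    by (simp add: represents_def)
  show ?thesis
    using sum represents_unique[OF _ sum] unfolding certificate_def C0_repr_def S
    by (rule theI[where P = "\<lambda>\<rho>. represents \<Omega> \<rho> _"])
qed

text \<open>The Fenchel inequality at the point \<open>measurement a u\<close>, combined with the equality of the two optimal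
  values, in which the finite value of \<open>fb\<close> cancels.\<close>

lemma primal_dual_pair_tv_norm_le:
  assumes pd: "primal_dual_pair \<Omega> L nK V W a fb u q" and fb: "\<And>y. fb y \<noteq> -\<infinity>"
  shows "tv_norm \<Omega> (L_meas \<Omega> L u) \<le> - (q \<bullet> measurement a u)"
proof -
  let ?B = "B_space \<Omega> L nK" and ?J = "primal_objective \<Omega> L a fb"
  have u: "u \<in> ?B" "?J u < \<infinity>" "\<And>v. v \<in> ?B \<Longrightarrow> ?J u \<le> ?J v"
    and q: "q \<in> dual_feasible \<Omega> L nK V W a"
      "\<And>r. r \<in> dual_feasible \<Omega> L nK V W a \<Longrightarrow> - fenchel_conjugate fb r \<le> - fenchel_conjugate fb q"
    and gap: "(INF v\<in>?B. ?J v) = (SUP r\<in>dual_feasible \<Omega> L nK V W a. - fenchel_conjugate fb r)"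
    using pd by (auto simp: primal_dual_pair_def primal_solution_def dual_solution_def)
  have "(INF v\<in>?B. ?J v) = ?J u"
    using u by (intro antisym INF_lower INF_greatest) auto
  moreover have "(SUP r\<in>dual_feasible \<Omega> L nK V W a. - fenchel_conjugate fb r) = - fenchel_conjugate fb q"
    using q by (intro antisym SUP_upper SUP_least) auto
  ultimately have eq: "?J u = - fenchel_conjugate fb q"
    using gap by simp
  obtain c where c: "fb (measurement a u) = ereal c"
    using u(2) fb[of "measurement a u"]
    by (cases "fb (measurement a u)") (auto simp: primal_objective_def)
  have "ereal (q \<bullet> measurement a u) - fb (measurement a u) \<le> fenchel_conjugate fb q"
    unfolding fenchel_conjugate_def by (rule SUP_upper) simp
  then have "ereal (q \<bullet> measurement a u - c) \<le> - ?J u"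
    using eq c by simp
  then show ?thesis
    using c by (simp add: primal_objective_def)
qed

text \<open>The constraint \<open>A\<^sup>* q \<in> ran L\<^sup>*\<close> enters the argument through this consequence: \<open>\<langle>q, A u\<rangle>\<close> depends on \<open>L u\<close> only.\<close>

lemma dual_feasible_orthogonal_kernel:
  assumes q: "q \<in> dual_feasible \<Omega> L nK V W a" and sub: "subspace (radon \<Omega>)" and k: "k \<in> L_kernel \<Omega> L nK"
  shows "q \<bullet> measurement a k = 0"
proof -
  obtain F where F: "linear_map_on (radon \<Omega>) F"
    "measurement_adjoint (B_space \<Omega> L nK) a q = adjoint_on (B_space \<Omega> L nK) (L_meas \<Omega> L) F"
    using q by (auto simp: dual_feasible_def dual_space_def)
  show ?thesis
    using fun_cong[OF F(2), of k] k linear_map_on_0[OF F(1) sub]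
    by (simp add: measurement_adjoint_def adjoint_on_def L_kernel_def kernel_on_def)
qed

text \<open>Linearity passes from \<open>L\<close> to the measure-valued operator because the embedding of the measures into the
  distributions is linear and injective.\<close>

lemma linear_map_on_L_meas:
  assumes \<Omega>: "open \<Omega>" and sub: "subspace (radon \<Omega>)" and S: "subspace (B_space \<Omega> L nK)"
    and L: "linear_map_on (distributions \<Omega>) L"
  shows "linear_map_on (B_space \<Omega> L nK) (L_meas \<Omega> L)"
proof -
  let ?B = "B_space \<Omega> L nK" and ?T = "L_meas \<Omega> L" and ?\<iota> = "measure_to_distribution \<Omega>"
  note inj = inj_on_measure_to_distribution[OF \<Omega> sub]
  have B: "v \<in> distributions \<Omega>" "?T v \<in> radon \<Omega>" "?\<iota> (?T v) = L v" if "v \<in> ?B" for v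
    using that unfolding L_meas_def B_space_def B_circ_def
    by (auto intro: the_inv_into_into[OF inj] f_the_inv_into_f[OF inj])
  have T_eqI: "?T v = \<mu>" if "\<mu> \<in> radon \<Omega>" "?\<iota> \<mu> = L v" for v \<mu>
    unfolding L_meas_def using that by (intro the_inv_into_f_eq[OF inj])
  show ?thesis
    unfolding linear_map_on_def
  proof (intro conjI ballI allI)
    fix v w assume vw: "v \<in> ?B" "w \<in> ?B"
    have "?\<iota> (?T v + ?T w) = ?\<iota> (?T v) + ?\<iota> (?T w)"
      by (simp add: measure_to_distribution_def fun_eq_iff)
    then show "?T (v + w) = ?T v + ?T w"
      using vw by (intro T_eqI subspace_add[OF sub]) (simp_all add: B linear_map_on_add[OF L])
  next
    fix c v assume v: "v \<in> ?B"
    have "?\<iota> (c *\<^sub>R ?T v) = c *\<^sub>R ?\<iota> (?T v)"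
      by (simp add: measure_to_distribution_def fun_eq_iff scaleR_fun_def)
    then show "?T (c *\<^sub>R v) = c *\<^sub>R ?T v"
      using v by (intro T_eqI subspace_scale[OF sub]) (simp_all add: B linear_map_on_scale[OF L])
  qed
qed

theorem proposition6:
  fixes \<Omega> :: "'a::euclidean_space set"
    and L :: "'a functional \<Rightarrow> 'a functional"
    and nK :: "'a functional \<Rightarrow> ennreal"
    and V W :: "'a functional set"
    and a :: "'m::finite \<Rightarrow> 'a functional \<Rightarrow> real"
    and fb :: "real ^ 'm \<Rightarrow> ereal"
    and u\<^sub>0 :: "'a functional"
    and q\<^sub>0 :: "real ^ 'm"
  assumes "open \<Omega>"
    and "continuous_linear_operator \<Omega> L"
    and "ext_seminorm_on (B_circ \<Omega> L) nK"
    and "\<forall>u\<in>kernel_on (distributions \<Omega>) L. nK u < \<infinity>"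
    and "norm_on (kernel_on (distributions \<Omega>) L) (\<lambda>u. enn2real (nK u))"
    and "banach_on (B_space \<Omega> L nK) (B_norm \<Omega> L nK)"
    and "norm_closed_on (B_space \<Omega> L nK) (B_norm \<Omega> L nK) V"
    and "direct_sum (L_kernel \<Omega> L nK) V (B_space \<Omega> L nK)"
    and "norm_closed_on (radon \<Omega>) (tv_norm \<Omega>) (L_range \<Omega> L nK)"
    and "norm_closed_on (radon \<Omega>) (tv_norm \<Omega>) W"
    and "direct_sum (L_range \<Omega> L nK) W (radon \<Omega>)"
    and "\<forall>i. a i \<in> dual_space (B_space \<Omega> L nK) (B_norm \<Omega> L nK)"
    and "\<forall>i. \<exists>\<rho>. represents \<Omega> \<rho> (adjoint_on (radon \<Omega>) (L_pinv \<Omega> L nK V W) (a i))"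
    and "\<exists>u. primal_solution \<Omega> L nK a fb u"
    and "\<forall>y. fb y \<noteq> -\<infinity>"
    and "convex_ereal fb"
    and "lower_semicontinuous fb"
    and "L_range \<Omega> L nK = radon \<Omega>"
    and "primal_dual_pair \<Omega> L nK V W a fb u\<^sub>0 q\<^sub>0"
  shows "supp_measure \<Omega> (L_meas \<Omega> L u\<^sub>0) \<subseteq> extremal_set \<Omega> L nK V W a q\<^sub>0 \<and>
    (\<forall>(p::nat) (x::nat \<Rightarrow> 'a).
       inj_on x {1..p} \<and> extremal_set \<Omega> L nK V W a q\<^sub>0 = x ` {1..p} \<longrightarrow>
       (\<exists>u\<^sub>K\<in>L_kernel \<Omega> L nK. \<exists>d::nat \<Rightarrow> real.
          u\<^sub>0 = u\<^sub>K + (\<Sum>k=1..p. d k *\<^sub>R L_pinv \<Omega> L nK V W (dirac \<Omega> (x k))))) \<and>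
    ((\<exists>!u. primal_solution \<Omega> L nK a fb u) \<longrightarrow>
       (\<forall>(p::nat) (x::nat \<Rightarrow> 'a) u\<^sub>K (d::nat \<Rightarrow> real).
          inj_on x {1..p} \<and> extremal_set \<Omega> L nK V W a q\<^sub>0 = x ` {1..p} \<and>
          u\<^sub>K \<in> L_kernel \<Omega> L nK \<and>
          u\<^sub>0 = u\<^sub>K + (\<Sum>k=1..p. d k *\<^sub>R L_pinv \<Omega> L nK V W (dirac \<Omega> (x k))) \<longrightarrow>
          card {k \<in> {1..p}. d k \<noteq> 0} \<le> sparsity_bound \<Omega> L nK a) \<and>
       (\<exists>p'\<le>sparsity_bound \<Omega> L nK a. \<exists>v\<^sub>K\<in>L_kernel \<Omega> L nK.
          \<exists>(c::nat \<Rightarrow> real) (y::nat \<Rightarrow> 'a). y ` {1..p'} \<subseteq> \<Omega> \<and>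
            u\<^sub>0 = v\<^sub>K + (\<Sum>k=1..p'. c k *\<^sub>R L_pinv \<Omega> L nK V W (dirac \<Omega> (y k)))))"
proof -
  define B where "B = B_space \<Omega> L nK"
  define T where "T = L_meas \<Omega> L"
  define P where "P = L_pinv \<Omega> L nK V W"
  define A where "A = measurement a"
  define \<mu> where "\<mu> = T u\<^sub>0"
  define \<eta> where "\<eta> = certificate \<Omega> L nK V W a q\<^sub>0"
  define I where "I = extremal_set \<Omega> L nK V W a q\<^sub>0"
  have ker: "L_kernel \<Omega> L nK = kernel_on B T"
    by (simp add: L_kernel_def B_def T_def)
  have ran: "T ` B = radon \<Omega>"
    using assms(18) by (simp add: L_range_def B_def T_def)
  have subR: "subspace (radon \<Omega>)"
    using assms(11,18) by (simp add: direct_sum_def)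
  have subB: "subspace B"
    using assms(6) by (simp add: banach_on_def norm_on_def B_def)
  have linT: "linear_map_on B T"
    unfolding B_def T_def
    using assms(2) by (intro linear_map_on_L_meas assms(1) subR subB[unfolded B_def])
      (simp add: continuous_linear_operator_def)
  have linA: "linear_map_on B A"
    using assms(12) unfolding A_def B_def measurement_def dual_space_def linear_map_on_def
    by (simp add: vec_eq_iff)
  have P_eq: "P = pseudoinverse B V W T"
    by (simp add: P_def L_pinv_def B_def T_def)
  have "direct_sum (kernel_on B T) V B" "direct_sum (T ` B) W (T ` B)"
    using assms(8,11,18) by (simp_all add: ker ran flip: B_def)
  note pinv = pseudoinverse_surjective[OF linT subB this, folded P_eq, unfolded ran]
  have P: "P \<nu> \<in> B" "T (P \<nu>) = \<nu>" if "\<nu> \<in> radon \<Omega>" for \<nu>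
    using pinv(1,2) that by blast+
  have linP: "linear_map_on (radon \<Omega>) P"
    by (rule pinv(3))
  have u: "primal_solution \<Omega> L nK a fb u\<^sub>0" and q: "q\<^sub>0 \<in> dual_feasible \<Omega> L nK V W a"
    using assms(19) by (auto simp: primal_dual_pair_def dual_solution_def)
  have uB: "u\<^sub>0 \<in> B"
    using u by (simp add: primal_solution_def B_def)
  then have \<mu>: "\<mu> \<in> radon \<Omega>"
    using ran by (auto simp: \<mu>_def)
  \<comment> \<open>As \<open>q\<^sub>0\<close> does not see this kernel part, the duality estimate turns into one on \<open>\<mu>\<close> alone.\<close>
  define u_ker where "u_ker = u\<^sub>0 - P \<mu>"
  have u_ker: "u_ker \<in> L_kernel \<Omega> L nK"
    using uB P[OF \<mu>] subspace_diff[OF subB] linear_map_on_diff[OF linT subB, of u\<^sub>0 "P \<mu>"]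
    by (simp add: ker kernel_on_def u_ker_def \<mu>_def)
  obtain \<rho> where \<rho>: "\<And>i. represents \<Omega> (\<rho> i) (adjoint_on (radon \<Omega>) P (a i))"
    using assms(13) unfolding P_def by metis
  have \<eta>: "represents \<Omega> \<eta> (adjoint_on (radon \<Omega>) P (measurement_adjoint B a q\<^sub>0))"
    unfolding \<eta>_def P_def
    by (rule certificate_represents[OF B_def \<rho>[unfolded P_def] P(1)[unfolded P_def]])
  have \<eta>C: "\<eta> \<in> C0 \<Omega>" and \<eta>\<mu>: "\<mu> \<eta> = q\<^sub>0 \<bullet> A (P \<mu>)"
    using \<eta> \<mu> P(1)[OF \<mu>] by (auto simp: represents_def adjoint_on_def measurement_adjoint_def A_def)
  have "sup_norm \<eta> \<le> 1"
    using q by (simp add: dual_feasible_def \<eta>_def)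
  then have \<eta>1: "\<bar>\<eta> x\<bar> \<le> 1" for x
    using C0_le_sup_norm[OF \<eta>C, of x] by linarith
  have "q\<^sub>0 \<bullet> A u_ker = 0"
    unfolding A_def by (rule dual_feasible_orthogonal_kernel[OF q subR u_ker])
  then have "q\<^sub>0 \<bullet> A u\<^sub>0 = \<mu> \<eta>"
    using linear_map_on_diff[OF linA subB uB P(1)[OF \<mu>]] by (simp add: u_ker_def \<eta>\<mu> inner_diff_right)
  then have tv: "tv_norm \<Omega> \<mu> \<le> - \<mu> \<eta>"
    using primal_dual_pair_tv_norm_le[OF assms(19)] assms(15) by (simp add: \<mu>_def T_def A_def)
  \<comment> \<open>The sign convention of the dual problem makes \<open>\<mu>\<close> attain its norm at the negative certificate.\<close>
  define \<zeta> where "\<zeta> x = (- 1) * \<eta> x + 0 * \<eta> x" for x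
  have \<zeta>: "\<zeta> \<in> C0 \<Omega>" "\<bar>\<zeta> x\<bar> \<le> 1" "tv_norm \<Omega> \<mu> \<le> \<mu> \<zeta>" for x
    using C0_lincomb[OF \<eta>C \<eta>C, of "- 1" 0] radon_lincomb[OF \<mu> \<eta>C \<eta>C, of "- 1" 0] \<eta>1[of x] tv
    by (simp_all add: \<zeta>_def[abs_def])
  have supp: "supp_measure \<Omega> \<mu> \<subseteq> I"
    using supp_subset_norming_set[OF assms(1) \<mu> \<zeta>] by (simp add: I_def extremal_set_def \<zeta>_def \<eta>_def)
  have I\<Omega>: "I \<subseteq> \<Omega>"
    by (auto simp: I_def extremal_set_def)
  have repr: "\<exists>d. u\<^sub>0 = u_ker + (\<Sum>k=1..p. d k *\<^sub>R P (dirac \<Omega> (x k)))"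
    if x: "inj_on x {1..p}" "supp_measure \<Omega> \<mu> \<subseteq> x ` {1..p}" "x ` {1..p} \<subseteq> \<Omega>" for p :: nat and x
  proof -
    obtain d where "\<mu> = (\<Sum>y\<in>x ` {1..p}. d y *\<^sub>R dirac \<Omega> y)"
      using finite_supp_sum_dirac[OF assms(1) subR \<mu> _ x(3,2)] by blast
    then have "\<mu> = (\<Sum>k=1..p. d (x k) *\<^sub>R dirac \<Omega> (x k))"
      unfolding sum.reindex[OF x(1)] o_def .
    then have "P \<mu> = (\<Sum>k=1..p. d (x k) *\<^sub>R P (dirac \<Omega> (x k)))"
      using linear_map_on_sum[OF linP subR dirac_radon] by simp
    then show ?thesis
      by (intro exI[of _ "\<lambda>k. d (x k)"]) (simp add: u_ker_def)
  qed
  have sparse: "finite (supp_measure \<Omega> \<mu>) \<and> card (supp_measure \<Omega> \<mu>) \<le> sparsity_bound \<Omega> L nK a"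
    if ex1: "\<exists>!u. primal_solution \<Omega> L nK a fb u"
  proof -
    have "v = u\<^sub>0" if v: "v \<in> B" "A v = A u\<^sub>0" "tv_norm \<Omega> (T v) \<le> tv_norm \<Omega> (T u\<^sub>0)" for v
    proof -
      have "primal_objective \<Omega> L a fb v \<le> primal_objective \<Omega> L a fb u\<^sub>0"
        using v unfolding primal_objective_def by (auto simp: A_def T_def intro: add_left_mono)
      then have "primal_solution \<Omega> L nK a fb v"
        using u v(1) unfolding primal_solution_def B_def by (meson le_less_trans order_trans)
      then show ?thesis using ex1 u by blast
    qed
    then have "finite (supp_measure \<Omega> (T u\<^sub>0)) \<and>
        card (supp_measure \<Omega> (T u\<^sub>0)) \<le> DIM(real ^ 'm) - dim (A ` kernel_on B T)"
      using \<mu> \<zeta> by (intro card_supp_le_if_unique[where P = P and \<zeta> = \<zeta>] assms(1) subR subB linT linA P linP uB)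
        (simp_all add: \<mu>_def)
    then show ?thesis
      by (simp add: sparsity_bound_def ker \<mu>_def A_def)
  qed
  show ?thesis
    unfolding T_def[symmetric] \<mu>_def[symmetric] I_def[symmetric] P_def[symmetric]
  proof (intro conjI allI impI)
    show "supp_measure \<Omega> \<mu> \<subseteq> I" by (rule supp)
  next
    fix p :: nat and x :: "nat \<Rightarrow> 'a"
    assume "inj_on x {1..p} \<and> I = x ` {1..p}"
    then show "\<exists>u\<^sub>K\<in>L_kernel \<Omega> L nK. \<exists>d. u\<^sub>0 = u\<^sub>K + (\<Sum>k=1..p. d k *\<^sub>R P (dirac \<Omega> (x k)))"
      using repr[of x p] supp I\<Omega> u_ker by blast
  next
    fix p :: nat and x :: "nat \<Rightarrow> 'a" and u\<^sub>K and d :: "nat \<Rightarrow> real"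
    assume ex1: "\<exists>!u. primal_solution \<Omega> L nK a fb u"
      and asm: "inj_on x {1..p} \<and> I = x ` {1..p} \<and> u\<^sub>K \<in> L_kernel \<Omega> L nK \<and>
        u\<^sub>0 = u\<^sub>K + (\<Sum>k=1..p. d k *\<^sub>R P (dirac \<Omega> (x k)))"
    have uK: "u\<^sub>K \<in> B" "T u\<^sub>K = 0"
      using asm by (auto simp: ker kernel_on_def)
    have PB: "P (dirac \<Omega> (x k)) \<in> B" for k
      by (rule P(1)[OF dirac_radon])
    have "(\<Sum>k=1..p. d k *\<^sub>R P (dirac \<Omega> (x k))) \<in> B"
      by (intro subspace_sum[OF subB] subspace_scale[OF subB] PB)
    then have "\<mu> = T (\<Sum>k=1..p. d k *\<^sub>R P (dirac \<Omega> (x k)))"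
      using asm linear_map_on_add[OF linT uK(1)] uK(2) by (simp add: \<mu>_def)
    also have "\<dots> = (\<Sum>k=1..p. d k *\<^sub>R dirac \<Omega> (x k))"
      by (simp add: linear_map_on_sum[OF linT subB PB] P(2)[OF dirac_radon])
    finally have \<mu>_sum: "\<mu> = (\<Sum>k=1..p. d k *\<^sub>R dirac \<Omega> (x k))" .
    have "x ` {k \<in> {1..p}. d k \<noteq> 0} \<subseteq> supp_measure \<Omega> \<mu>"
    proof
      fix y assume "y \<in> x ` {k \<in> {1..p}. d k \<noteq> 0}"
      then obtain k where k: "k \<in> {1..p}" "d k \<noteq> 0" "y = x k" by blast
      show "y \<in> supp_measure \<Omega> \<mu>"
        unfolding \<mu>_sum k(3) by (rule atom_in_supp) (use k asm I\<Omega> in auto)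
    qed
    then have "card (x ` {k \<in> {1..p}. d k \<noteq> 0}) \<le> card (supp_measure \<Omega> \<mu>)"
      using sparse[OF ex1] by (intro card_mono) simp_all
    moreover have "card (x ` {k \<in> {1..p}. d k \<noteq> 0}) = card {k \<in> {1..p}. d k \<noteq> 0}"
      by (rule card_image, rule inj_on_subset[of x "{1..p}"]) (use asm in auto)
    ultimately show "card {k \<in> {1..p}. d k \<noteq> 0} \<le> sparsity_bound \<Omega> L nK a"
      using sparse[OF ex1] by simp
  next
    assume ex1: "\<exists>!u. primal_solution \<Omega> L nK a fb u"
    define p where "p = card (supp_measure \<Omega> \<mu>)"
    obtain y where y: "bij_betw y {1..p} (supp_measure \<Omega> \<mu>)"
      using ex_bij_betw_nat_finite_1 sparse[OF ex1] unfolding p_def by blast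
    then have "y ` {1..p} = supp_measure \<Omega> \<mu>" "inj_on y {1..p}"
      by (auto simp: bij_betw_def)
    moreover from this obtain c where "u\<^sub>0 = u_ker + (\<Sum>k=1..p. c k *\<^sub>R P (dirac \<Omega> (y k)))"
      using repr[of y p] supp I\<Omega> by blast
    moreover have "p \<le> sparsity_bound \<Omega> L nK a"
      using sparse[OF ex1] by (simp add: p_def)
    ultimately show "\<exists>p'\<le>sparsity_bound \<Omega> L nK a. \<exists>v\<^sub>K\<in>L_kernel \<Omega> L nK. \<exists>c y.
        y ` {1..p'} \<subseteq> \<Omega> \<and> u\<^sub>0 = v\<^sub>K + (\<Sum>k=1..p'. c k *\<^sub>R P (dirac \<Omega> (y k)))"
      using u_ker supp I\<Omega> by blast
  qed
qed

end
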